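(* Let $r\ge 2$ be an integer and let $G$ be a graph with no subgraph isomorphic to $K_{r,r}$. Then $$\mathrm{cw}(G)< \frac{2(r-2)}{r+1} \binom{\mathrm{rw}(G)}{r}+ 2\sum_{i=0}^r \binom{\mathrm{rw}(G)}{i}$$ and $$\mathrm{tw}(G)+1<3(r-1)\left(\frac{2(r-2)}{r+1} \binom{\mathrm{rw}(G)}{r}+ 2\sum_{i=0}^r \binom{\mathrm{rw}(G)}{i} \right).$$
   Context: All graphs are finite, simple and undirected. $K_{r,r}$ is the complete bipartite graph with $r$ vertices on each side; subgraphs are not necessarily induced. $\mathrm{tw}(G)$ denotes the tree-width of $G$ (minimum over tree decompositions of the maximum bag size minus one). Rank-width. For $X\subseteq V(G)$, the cut-rank $\rho_G(X)$ is the rank over $\mathrm{GF}(2)$ of the $X\times (V(G)\setminus X)$ matrix whose $(i,j)$ entry is $1$ iff $i$ and $j$ are adjacent in $G$; $\rho_G(\emptyset)=\rho_G(V(G))=0$. A tree is ternary if all its vertices have degree $1$ or $3$. A rank-decomposition of $G$ is a pair $(T,\mu)$ of a ternary tree $T$ and a bijection $\mu$ from $V(G)$ to the set $L(T)$ of leaves of $T$. Each edge $e$ of $T$ defines a partition $(X_e,Y_e)$ of $L(T)$ (leaves of the two components of $T\setminus e$); the width of $e$ is $\rho_G(\mu^{-1}(X_e))$, and the width of $(T,\mu)$ is the maximum width of its edges. The rank-width $\mathrm{rw}(G)$ is the minimum width of all rank-decompositions of $G$ (and is $0$ if $|V(G)|\le 1$). Clique-width. A $k$-graph is a pair $(G,\mathrm{lab})$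 with $\mathrm{lab}:V(G)\to\{1,\dots,k\}$. $k$-expressions are built from: $\cdot_i$ (a single vertex with label $i$); $\rho_{i\to j}$ with $i\ne j$ (relabel every vertex of label $i$ to $j$); $\eta_{i,j}$ with $i\neq j$ (add all edges between vertices of label $i$ and vertices of label $j$); $\oplus$ (disjoint union of two $k$-graphs). The clique-width $\mathrm{cw}(G)$ is the minimum $k$ such that some $k$-expression has value $(G,\mathrm{lab})$ for some labeling $\mathrm{lab}$. *)

theory Defs
  imports Complex_Main "HOL-Library.Z2" "HOL-Library.Function_Algebras" "Graph_Theory.Graph_Theory"
begin

text \<open>
  A finite simple undirected graph is a \<^locale>\<open>pair_graph\<close>: a finite, symmetric, loop-free
  digraph in which each edge is represented by its two opposite arcs. The null graph is allowed.
\<close>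

section \<open>Trees\<close>

text \<open>
  The notion of tree of \<^theory>\<open>Graph_Theory.Digraph_Component\<close> is not usable here: in a
  symmetric digraph an edge traversed back and forth is already a (directed) cycle of length 2.
  The cycles of the undirected graph are the directed cycles of length at least 3.
\<close>

definition undirected_tree :: "'t pair_pre_digraph \<Rightarrow> bool" where
  "undirected_tree T \<longleftrightarrow>
     pair_graph T \<and> Digraph_Component.connected (with_proj T) \<and>
     \<not> (\<exists>p. pre_digraph.cycle (with_proj T) p \<and> 3 \<le> length p)"

definition degree :: "'t pair_pre_digraph \<Rightarrow> 't \<Rightarrow> nat" where
  "degree T t = out_degree (with_proj T) t"

definition leaves :: "'t pair_pre_digraph \<Rightarrow> 't set" where
  "leaves T = {t \<in> pverts T. degree T t = 1}"

definition ternary_tree :: "'t pair_pre_digraph \<Rightarrow> bool" where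
  "ternary_tree T \<longleftrightarrow> undirected_tree T \<and> (\<forall>t \<in> pverts T. degree T t = 1 \<or> degree T t = 3)"

definition del_edge :: "'t pair_pre_digraph \<Rightarrow> 't \<Rightarrow> 't \<Rightarrow> 't pair_pre_digraph" where
  "del_edge T s t = \<lparr>pverts = pverts T, parcs = parcs T - {(s, t), (t, s)}\<rparr>"

text \<open>In a symmetric digraph, the strongly connected components are the connected components.\<close>

definition components :: "'t pair_pre_digraph \<Rightarrow> 't set set" where
  "components T = pre_digraph.sccs_verts (with_proj T)"


section \<open>Tree-width\<close>

definition tree_decomposition ::
  "'a pair_pre_digraph \<Rightarrow> 't pair_pre_digraph \<Rightarrow> ('t \<Rightarrow> 'a set) \<Rightarrow> bool" where
  "tree_decomposition G T B \<longleftrightarrow>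
     undirected_tree T \<and>
     (\<Union>t \<in> pverts T. B t) = pverts G \<and>
     (\<forall>(u, v) \<in> parcs G. \<exists>t \<in> pverts T. u \<in> B t \<and> v \<in> B t) \<and>
     (\<forall>v \<in> pverts G.
        Digraph_Component.connected (induce_subgraph (with_proj T) {t \<in> pverts T. v \<in> B t}))"

text \<open>
  Trees with nodes in \<^typ>\<open>nat\<close> represent all finite trees up to isomorphism.
  The value is an integer because the null graph has tree-width -1.
\<close>

definition tree_width :: "'a pair_pre_digraph \<Rightarrow> int" where
  "tree_width G =
     int (LEAST k. \<exists>(T :: nat pair_pre_digraph) B.
            tree_decomposition G T B \<and> k = Max ((\<lambda>t. card (B t)) ` pverts T)) - 1"


section \<open>Rank-width\<close>

text \<open>Vectors over GF(2), i.e. over the field \<^typ>\<open>bit\<close>, with entries indexed by \<open>'j\<close>.\<close>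

definition gf2_scale :: "bit \<Rightarrow> ('j \<Rightarrow> bit) \<Rightarrow> 'j \<Rightarrow> bit" where
  "gf2_scale c f = (\<lambda>j. c * f j)"

lemma vector_space_gf2_scale: "vector_space gf2_scale"
  by unfold_locales (auto simp: gf2_scale_def fun_eq_iff algebra_simps)

text \<open>
  The rank of the \<open>I \<times> J\<close> matrix with entries \<open>A i j\<close>, as the dimension of the row space.
  Rows are extended by zero outside \<open>J\<close>.
\<close>

definition gf2_rank :: "'i set \<Rightarrow> 'j set \<Rightarrow> ('i \<Rightarrow> 'j \<Rightarrow> bit) \<Rightarrow> nat" where
  "gf2_rank I J A = vector_space.dim gf2_scale ((\<lambda>i j. if j \<in> J then A i j else 0) ` I)"

definition cut_rank :: "'a pair_pre_digraph \<Rightarrow> 'a set \<Rightarrow> nat" where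
  "cut_rank G X = gf2_rank X (pverts G - X) (\<lambda>u v. of_bool ((u, v) \<in> parcs G))"

definition rank_decomposition ::
  "'a pair_pre_digraph \<Rightarrow> 't pair_pre_digraph \<Rightarrow> ('a \<Rightarrow> 't) \<Rightarrow> bool" where
  "rank_decomposition G T \<mu> \<longleftrightarrow> ternary_tree T \<and> bij_betw \<mu> (pverts G) (leaves T)"

text \<open>
  Both components of \<open>T\<close> minus an edge contribute to the maximum; their contributions are equal
  since the cut-rank of a set and of its complement are ranks of transposed matrices.
\<close>

definition rank_decomposition_width ::
  "'a pair_pre_digraph \<Rightarrow> 't pair_pre_digraph \<Rightarrow> ('a \<Rightarrow> 't) \<Rightarrow> nat" where
  "rank_decomposition_width G T \<mu> =
     Max {cut_rank G {v \<in> pverts G. \<mu> v \<in> C} | s t C.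
            (s, t) \<in> parcs T \<and> C \<in> components (del_edge T s t)}"

definition rank_width :: "'a pair_pre_digraph \<Rightarrow> nat" where
  "rank_width G =
     (if card (pverts G) \<le> 1 then 0
      else LEAST k. \<exists>(T :: nat pair_pre_digraph) \<mu>.
             rank_decomposition G T \<mu> \<and> k = rank_decomposition_width G T \<mu>)"


section \<open>Clique-width\<close>

datatype kexp =
    Vertex nat
  | Relabel nat nat kexp
  | Join nat nat kexp
  | DisjUnion kexp kexp

fun is_kexp :: "nat \<Rightarrow> kexp \<Rightarrow> bool" where
  "is_kexp k (Vertex i) \<longleftrightarrow> i \<in> {1..k}"
| "is_kexp k (Relabel i j e) \<longleftrightarrow> i \<in> {1..k} \<and> j \<in> {1..k} \<and> i \<noteq> j \<and> is_kexp k e"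
| "is_kexp k (Join i j e) \<longleftrightarrow> i \<in> {1..k} \<and> j \<in> {1..k} \<and> i \<noteq> j \<and> is_kexp k e"
| "is_kexp k (DisjUnion e1 e2) \<longleftrightarrow> is_kexp k e1 \<and> is_kexp k e2"

text \<open>
  The value of an expression is a labelled graph determined up to isomorphism, hence a relation:
  \<open>kexp_value e G lab\<close> holds for every concrete copy \<open>(G, lab)\<close> of the value of \<open>e\<close>.
  Labels outside the vertex set are irrelevant.
\<close>

inductive kexp_value :: "kexp \<Rightarrow> 'a pair_pre_digraph \<Rightarrow> ('a \<Rightarrow> nat) \<Rightarrow> bool" where
  vertex:
    "lab v = i \<Longrightarrow> kexp_value (Vertex i) \<lparr>pverts = {v}, parcs = {}\<rparr> lab"
| relabel:
    "kexp_value e G lab \<Longrightarrow>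
     kexp_value (Relabel i j e) G (\<lambda>v. if lab v = i then j else lab v)"
| join:
    "kexp_value e G lab \<Longrightarrow>
     kexp_value (Join i j e)
       \<lparr>pverts = pverts G,
        parcs = parcs G \<union>
          {(u, v) \<in> pverts G \<times> pverts G. (lab u = i \<and> lab v = j) \<or> (lab u = j \<and> lab v = i)}\<rparr>
       lab"
| disj_union:
    "kexp_value e1 G1 lab1 \<Longrightarrow> kexp_value e2 G2 lab2 \<Longrightarrow>
     pverts G1 \<inter> pverts G2 = {} \<Longrightarrow>
     (\<forall>v \<in> pverts G1. lab v = lab1 v) \<Longrightarrow> (\<forall>v \<in> pverts G2. lab v = lab2 v) \<Longrightarrow>
     kexp_value (DisjUnion e1 e2)
       \<lparr>pverts = pverts G1 \<union> pverts G2, parcs = parcs G1 \<union> parcs G2\<rparr> lab"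

text \<open>The null graph is not the value of any expression; its clique-width is set to 0.\<close>

definition clique_width :: "'a pair_pre_digraph \<Rightarrow> nat" where
  "clique_width G =
     (if pverts G = {} then 0
      else LEAST k. \<exists>e lab. is_kexp k e \<and> kexp_value e G lab)"


section \<open>Excluding complete bipartite subgraphs\<close>

text \<open>
  The predicate \<^const>\<open>complete_bipartite_digraph\<close> \<open>r r\<close> characterises the graphs isomorphic
  to the complete bipartite graph with \<open>r\<close> vertices on each side.
\<close>

definition has_Krr_subgraph :: "nat \<Rightarrow> 'a pair_pre_digraph \<Rightarrow> bool" where
  "has_Krr_subgraph r G \<longleftrightarrow>
     (\<exists>H :: 'a pair_pre_digraph.
        subgraph (with_proj H) (with_proj G) \<and> complete_bipartite_digraph r r (with_proj H))"

end

theory Submission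
  imports Defs
begin

text \<open>
  Call two vertices of a set \<open>X\<close> twins if they have the same neighbours outside \<open>X\<close>, and call the
  nonempty neighbourhoods outside \<open>X\<close> that occur the traces of \<open>X\<close>. They are the distinct nonzero
  rows of the matrix whose rank is the cut-rank of \<open>X\<close>. If this rank is at most \<open>k\<close>, then \<open>k\<close>
  columns suffice to tell the rows apart, so that the traces, together with the empty set, may be
  regarded as a family of subsets of a \<open>k\<close>-element set. As \<open>K\<^bsub>r,r\<^esub>\<close> is excluded, every \<open>r\<close>-element
  set lies in at most \<open>r - 1\<close> of them, and double counting bounds the size of the family by
  \<open>f k = (r - 2) / (r + 1) * (k choose r) + (\<Sum>i = 0..r. k choose i)\<close>
  (lemmas \<open>separating_coordinates\<close>, \<open>card_r_bounded_family\<close> and \<open>card_traces_le\<close>).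
  
  Rooting an optimal rank-decomposition at an edge turns it into a recursive bisection of the
  vertex set all of whose parts have at most \<open>m\<close> traces, where \<open>m + 1 \<le> f k\<close>
  (\<open>cluster_of_rank_decomposition\<close>). Both bounds follow by induction along this bisection.
  
  Clique-width: the graph induced on a part is built with one label for each class of twins with a
  nonempty trace, and one more label for the vertices without outside neighbours. To unite two
  parts, use disjoint sets of \<open>m\<close> labels for them; twins behave alike towards the other part, hence
  all edges in between arise from joins of labels. Then merge the labels of vertices that became
  twins. This takes \<open>2 * m + 1 < 2 * f k\<close> labels (\<open>clique_width_le_cluster\<close>).
  
  Tree-width: there is no detour through clique-width. For every part \<open>X\<close> the edges
  leaving \<open>X\<close> have a canonical vertex cover: from each class of twins with a nonempty trace take the
  class itself if it has fewer than \<open>r\<close> elements, and its trace otherwise, which then has fewer than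
  \<open>r\<close> elements since the class and its trace span a complete bipartite graph. So the cover has at
  most \<open>m * (r - 1)\<close> elements. Give each part of the bisection the bag consisting of its own cover
  and the covers of its two halves. Twins stay twins when the part grows, so small classes can only
  become large and never the other way round; together with the exclusion of \<open>K\<^bsub>r,r\<^esub>\<close> this makes the
  set of bags containing a given vertex connected. The bags have at most \<open>3 * m * (r - 1)\<close> elements, or
  a single one (\<open>tree_width_le_cluster\<close>); this is less than half of the asserted bound.
\<close>

section \<open>Matrices of bounded rank over GF(2)\<close>

text \<open>
  If no coordinate can be dropped from a set \<open>C\<close> that separates the vectors of the span, then every
  \<open>c \<in> C\<close> has a witness in the span that vanishes on \<open>C - {c}\<close> but not at \<open>c\<close>. These witnesses are
  linearly independent, so \<open>C\<close> is no larger than the dimension. The zero vector is included because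
  nonzero rows must also stay nonzero on \<open>C\<close>.
\<close>

lemma separating_coordinates:
  assumes "finite J" and "finite R" and supp: "\<And>f j. f \<in> R \<Longrightarrow> j \<notin> J \<Longrightarrow> f j = 0"
  shows "\<exists>C \<subseteq> J. card C \<le> vector_space.dim gf2_scale R \<and>
    (\<forall>f \<in> insert 0 R. \<forall>g \<in> insert 0 R. (\<forall>c \<in> C. f c = g c) \<longrightarrow> f = g)"
proof -
  interpret vector_space "gf2_scale :: bit \<Rightarrow> ('a \<Rightarrow> bit) \<Rightarrow> 'a \<Rightarrow> bit"
    by (rule vector_space_gf2_scale)
  have sub0: "subspace {f. f c = 0}" for c :: 'a
    by (auto simp: subspace_def gf2_scale_def)
  have supp_span: "f j = 0" if "f \<in> span R" "j \<notin> J" for f j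
    using span_minimal[OF _ sub0[of j], of R] supp that by auto
  define sep where "sep C \<longleftrightarrow> C \<subseteq> J \<and> (\<forall>f \<in> span R. (\<forall>c \<in> C. f c = 0) \<longrightarrow> f = 0)" for C
  have "sep J"
    using supp_span unfolding sep_def by (auto simp: fun_eq_iff)
  then obtain C where C: "sep C" and min: "\<And>D. sep D \<Longrightarrow> card C \<le> card D"
    using arg_min_nat_lemma[of sep J card] by blast
  have "C \<subseteq> J" using C by (auto simp: sep_def)
  then have "finite C" using \<open>finite J\<close> by (rule finite_subset)
  have "\<exists>f. f \<in> span R \<and> (\<forall>d \<in> C - {c}. f d = 0) \<and> f c \<noteq> 0" if "c \<in> C" for c
  proof -
    have "card (C - {c}) < card C"
      using \<open>finite C\<close> that by (rule card_Diff1_less)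
    then have "\<not> sep (C - {c})" using min by (meson leD)
    then obtain f where f: "f \<in> span R" "\<forall>d \<in> C - {c}. f d = 0" "f \<noteq> 0"
      using \<open>C \<subseteq> J\<close> by (auto simp: sep_def)
    moreover have "f c \<noteq> 0"
    proof
      assume "f c = 0"
      then have "\<forall>d \<in> C. f d = 0" using f(2) by auto
      then show False using C f(1,3) by (auto simp: sep_def)
    qed
    ultimately show ?thesis by blast
  qed
  then obtain w where w: "\<And>c. c \<in> C \<Longrightarrow> w c \<in> span R"
    "\<And>c d. c \<in> C \<Longrightarrow> d \<in> C - {c} \<Longrightarrow> w c d = 0" "\<And>c. c \<in> C \<Longrightarrow> w c c \<noteq> 0"
    by metis
  have inj: "inj_on w C"
  proof (rule inj_onI, rule ccontr)
    fix c d assume "c \<in> C" "d \<in> C" "w c = w d" "c \<noteq> d"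
    then show False using w(2)[of c d] w(3)[of d] by simp
  qed
  have "independent (w ` C)"
    unfolding dependent_def
  proof clarify
    fix c assume c: "c \<in> C" "w c \<in> span (w ` C - {w c})"
    have "w ` C - {w c} \<subseteq> {f. f c = 0}" using w(2) c(1) by auto
    from span_minimal[OF this sub0] c(2) have "w c c = 0" by blast
    with w(3) c(1) show False by blast
  qed
  moreover obtain B where B: "B \<subseteq> R" "R \<subseteq> span B" "card B = dim R"
    by (rule basis_exists)
  moreover have "w ` C \<subseteq> span B"
    using w(1) span_minimal[OF B(2) subspace_span] by auto
  ultimately have "card (w ` C) \<le> dim R"
    using independent_span_bound[of B "w ` C"] finite_subset[OF B(1) \<open>finite R\<close>] by simp
  then have "card C \<le> dim R" by (simp add: card_image[OF inj])
  moreover have "f = g"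
    if "f \<in> insert 0 R" "g \<in> insert 0 R" "\<forall>c \<in> C. f c = g c" for f g
  proof -
    have "f - g \<in> span R"
      using that(1,2) by (intro span_diff) (auto simp: span_zero span_base)
    moreover have "\<forall>c \<in> C. (f - g) c = 0" using that(3) by simp
    ultimately have "f - g = 0" using C by (auto simp: sep_def)
    then show ?thesis by (metis right_minus_eq)
  qed
  ultimately show ?thesis using \<open>C \<subseteq> J\<close> by blast
qed

section \<open>Counting traces\<close>

text \<open>
  Half of the asserted bound on clique-width. With \<open>(r - 1)\<close> sets above each \<open>r\<close>-element set, the
  sum comes from the sets with fewer than \<open>r\<close> elements and the sets with exactly \<open>r\<close> elements, and
  the fraction from the larger ones.
\<close>

definition trace_bound :: "nat \<Rightarrow> nat \<Rightarrow> real" where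
  "trace_bound r k = (real r - 2) / (real r + 1) * real (k choose r) + (\<Sum>i = 0..r. real (k choose i))"

lemma trace_bound_mono:
  assumes "2 \<le> r" "k \<le> l"
  shows "trace_bound r k \<le> trace_bound r l"
  unfolding trace_bound_def using assms
  by (intro add_mono mult_left_mono sum_mono) (auto intro: binomial_right_mono)

text \<open>
  Count the pairs of an \<open>r\<close>-element set \<open>D\<close> and a member \<open>s \<supseteq> D\<close> of the family. A member with
  exactly \<open>r\<close> elements contributes one pair and a larger one at least \<open>r + 1\<close> pairs, so the numbers
  \<open>M\<close> and \<open>H\<close> of such members satisfy \<open>M + (r + 1) * H \<le> (r - 1) * (c choose r)\<close>. Subject to
  \<open>M \<le> (c choose r)\<close> the sum \<open>M + H\<close> is largest for \<open>M = (c choose r)\<close>.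
\<close>

lemma card_r_bounded_family:
  assumes "finite C" "S \<subseteq> Pow C" "2 \<le> r"
    and deg: "\<And>D. D \<subseteq> C \<Longrightarrow> card D = r \<Longrightarrow> card {s \<in> S. D \<subseteq> s} \<le> r - 1"
  shows "real (card S) \<le> trace_bound r (card C)"
proof -
  let ?c = "card C"
  have fin: "finite S" "\<And>s. s \<in> S \<Longrightarrow> finite s" "\<And>s. s \<in> S \<Longrightarrow> s \<subseteq> C"
    using assms(1,2) by (auto intro: finite_subset)
  define L where "L = {s \<in> S. card s < r}"
  define M where "M = {s \<in> S. card s = r}"
  define H where "H = {s \<in> S. r < card s}"
  have S: "S = L \<union> M \<union> H" by (auto simp: L_def M_def H_def)
  have card_S: "card S = card L + card M + card H"
    unfolding S using fin(1)
    by (subst card_Un_disjoint; (subst card_Un_disjoint)?) (auto simp: L_def M_def H_def)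
  have "card L \<le> card (\<Union>i<r. {s. s \<subseteq> C \<and> card s = i})"
    using fin assms(1) by (intro card_mono) (auto simp: L_def)
  also have "\<dots> \<le> (\<Sum>i<r. card {s. s \<subseteq> C \<and> card s = i})"
    by (rule card_UN_le) simp
  also have "\<dots> = (\<Sum>i<r. ?c choose i)"
    by (simp add: n_subsets[OF assms(1)])
  finally have L: "real (card L) \<le> (\<Sum>i<r. real (?c choose i))"
    by (metis of_nat_le_iff of_nat_sum)
  have "card M \<le> card {s. s \<subseteq> C \<and> card s = r}"
    using fin assms(1) by (intro card_mono) (auto simp: M_def)
  then have M: "card M \<le> ?c choose r"
    by (simp add: n_subsets[OF assms(1)])
  let ?R = "{D. D \<subseteq> C \<and> card D = r}"
  have finR: "finite ?R" using assms(1) by simp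
  have "card M + (r + 1) * card H = (\<Sum>s\<in>M. 1) + (\<Sum>s\<in>H. r + 1)" by simp
  also have "\<dots> \<le> (\<Sum>s\<in>M. card s choose r) + (\<Sum>s\<in>H. card s choose r)"
  proof (intro add_mono sum_mono)
    fix s assume "s \<in> H"
    then have "Suc r \<le> card s" by (auto simp: H_def)
    from binomial_right_mono[OF this, of r] show "r + 1 \<le> card s choose r" by simp
  qed (auto simp: M_def)
  also have "\<dots> = (\<Sum>s\<in>M \<union> H. card s choose r)"
    using fin(1) by (subst sum.union_disjoint) (auto simp: M_def H_def)
  also have "\<dots> \<le> (\<Sum>s\<in>S. card s choose r)"
    using fin(1) by (intro sum_mono2) (auto simp: S)
  also have "\<dots> = (\<Sum>s\<in>S. card {D \<in> ?R. D \<subseteq> s})"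
  proof (rule sum.cong[OF refl])
    fix s assume "s \<in> S"
    then have "{D \<in> ?R. D \<subseteq> s} = {D. D \<subseteq> s \<and> card D = r}" using fin(3) by auto
    then show "card s choose r = card {D \<in> ?R. D \<subseteq> s}"
      using fin(2) \<open>s \<in> S\<close> by (simp add: n_subsets)
  qed
  also have "\<dots> = (\<Sum>D\<in>?R. card {s \<in> S. D \<subseteq> s})"
    by (rule sum_multicount_gen[OF fin(1) finR]) (simp add: Collect_conj_eq)
  also have "\<dots> \<le> (\<Sum>D\<in>?R. r - 1)"
    by (intro sum_mono deg) auto
  also have "\<dots> = (r - 1) * (?c choose r)"
    by (simp add: n_subsets[OF assms(1)])
  finally have "real (card M + (r + 1) * card H) \<le> real ((r - 1) * (?c choose r))"
    by (simp only: of_nat_le_iff)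
  then have MH: "real (card M) + (real r + 1) * real (card H) \<le> (real r - 1) * real (?c choose r)"
    using assms(3) by (simp add: of_nat_diff algebra_simps)
  \<comment> \<open>This is the double counting inequality plus \<open>r\<close> times the bound on the number of \<open>r\<close>-element members.\<close>
  have "(real r + 1) * (real (card M) + real (card H)) \<le> (2 * real r - 1) * real (?c choose r)"
    using MH mult_left_mono[of "real (card M)" "real (?c choose r)" "real r"] M
    by (simp add: algebra_simps)
  then have "real (card M) + real (card H) \<le> (2 * real r - 1) * real (?c choose r) / (real r + 1)"
    by (simp add: field_simps)
  also have "\<dots> = (real r - 2) / (real r + 1) * real (?c choose r) + real (?c choose r)"
    by (simp add: field_simps)
  finally have "real (card S) \<le> (real r - 2) / (real r + 1) * real (?c choose r)
      + real (?c choose r) + (\<Sum>i<r. real (?c choose i))"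
    using L by (simp add: card_S)
  then show ?thesis
    by (simp add: trace_bound_def atLeast0AtMost lessThan_Suc_atMost[symmetric])
qed

definition outer_nbrs :: "'a pair_pre_digraph \<Rightarrow> 'a set \<Rightarrow> 'a \<Rightarrow> 'a set" where
  "outer_nbrs G X u = {w \<in> pverts G - X. (u, w) \<in> parcs G}"

lemma outer_nbrs_superset: "X \<subseteq> Y \<Longrightarrow> outer_nbrs G Y u = outer_nbrs G X u - Y"
  by (auto simp: outer_nbrs_def)

text \<open>
  Vertices without neighbours outside \<open>X\<close> need no individual treatment later on, hence the empty
  neighbourhood is left out.
\<close>

definition traces :: "'a pair_pre_digraph \<Rightarrow> 'a set \<Rightarrow> 'a set set" where
  "traces G X = outer_nbrs G X ` X - {{}}"

lemma no_Krr_biclique: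
  assumes G: "pair_graph G" and K: "\<not> has_Krr_subgraph r G"
    and UD: "U \<subseteq> pverts G" "D \<subseteq> pverts G" "U \<inter> D = {}" "U \<times> D \<subseteq> parcs G"
    and "r \<le> card U"
  shows "card D < r"
proof (rule ccontr)
  interpret pair_graph G by (rule G)
  assume "\<not> card D < r"
  then obtain U' D' where *: "U' \<subseteq> U" "card U' = r" "D' \<subseteq> D" "card D' = r"
    using \<open>r \<le> card U\<close> by (meson not_less obtain_subset_with_card_n)
  define H where "H = \<lparr>pverts = U' \<union> D', parcs = U' \<times> D' \<union> D' \<times> U'\<rparr>"
  have fin: "finite (U' \<union> D')"
    using * UD pair_finite_verts by (meson finite_Un finite_subset subset_trans)
  have "complete_bipartite_digraph r r (with_proj H)"
    unfolding complete_bipartite_digraph_pair_def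
    using * UD fin by (intro conjI exI[of _ U'] exI[of _ D']) (auto simp: H_def)
  moreover have "subgraph (with_proj H) (with_proj G)"
  proof (rule subgraphI)
    show "wf_digraph (with_proj H)"
      unfolding wf_digraph_wp_iff by unfold_locales (auto simp: H_def)
    show "wf_digraph (with_proj G)" by unfold_locales
    show "arcs (with_proj H) \<subseteq> arcs (with_proj G)"
      using * UD arcs_symmetric by (auto simp: H_def; blast)
  qed (use * UD in \<open>auto simp: H_def\<close>)
  ultimately show False using K by (auto simp: has_Krr_subgraph_def)
qed

text \<open>
  Restricting traces to separating columns \<open>C\<close> is injective, even on the traces together with the
  empty set; this accounts for the summand 1. If \<open>r\<close> different traces contained the same \<open>r\<close>
  columns, then choosing a vertex for each of them would give a \<open>K\<^bsub>r,r\<^esub>\<close>.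
\<close>

lemma card_traces_le:
  assumes G: "pair_graph G" and K: "\<not> has_Krr_subgraph r G" and "2 \<le> r"
    and X: "X \<subseteq> pverts G" and k: "cut_rank G X \<le> k"
  shows "real (card (traces G X)) + 1 \<le> trace_bound r k"
proof -
  interpret pair_graph G by (rule G)
  have finX: "finite X" using X pair_finite_verts by (rule finite_subset)
  let ?J = "pverts G - X"
  define row :: "'a \<Rightarrow> 'a \<Rightarrow> bit"
    where "row u = (\<lambda>j. if j \<in> ?J then of_bool ((u, j) \<in> parcs G) else 0)" for u
  have rank: "vector_space.dim gf2_scale (row ` X) \<le> k"
    using k by (simp add: cut_rank_def gf2_rank_def row_def[abs_def])
  have "\<exists>C \<subseteq> ?J. card C \<le> vector_space.dim gf2_scale (row ` X) \<and>
    (\<forall>f \<in> insert 0 (row ` X). \<forall>g \<in> insert 0 (row ` X). (\<forall>c \<in> C. f c = g c) \<longrightarrow> f = g)"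
    using finX pair_finite_verts by (intro separating_coordinates) (auto simp: row_def)
  then obtain C where C: "C \<subseteq> ?J" "card C \<le> vector_space.dim gf2_scale (row ` X)"
    and sep: "\<And>f g. f \<in> insert 0 (row ` X) \<Longrightarrow> g \<in> insert 0 (row ` X) \<Longrightarrow>
      \<forall>c \<in> C. f c = g c \<Longrightarrow> f = g"
    by metis
  have finC: "finite C" using C(1) pair_finite_verts by (meson finite_Diff finite_subset)
  define ind :: "'a set \<Rightarrow> 'a \<Rightarrow> bit" where "ind T = (\<lambda>j. of_bool (j \<in> T))" for T
  have ind_row: "ind (outer_nbrs G X u) = row u" for u
    by (auto simp: ind_def row_def outer_nbrs_def fun_eq_iff)
  have ind_mem: "ind T \<in> insert 0 (row ` X)" if "T \<in> insert {} (traces G X)" for T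
    using that
  proof
    assume "T = {}" then show ?thesis by (simp add: ind_def zero_fun_def)
  next
    assume "T \<in> traces G X"
    then show ?thesis using ind_row by (auto simp: traces_def)
  qed
  have inj: "inj_on (\<lambda>T. T \<inter> C) (insert {} (traces G X))"
  proof (rule inj_onI)
    fix T T' assume T: "T \<in> insert {} (traces G X)" "T' \<in> insert {} (traces G X)" "T \<inter> C = T' \<inter> C"
    have "ind T = ind T'"
    proof (rule sep[OF ind_mem[OF T(1)] ind_mem[OF T(2)]], rule ballI)
      fix c assume "c \<in> C"
      then have "c \<in> T \<longleftrightarrow> c \<in> T'" using T(3) by blast
      then show "ind T c = ind T' c" by (simp add: ind_def)
    qed
    then have "of_bool (j \<in> T) = (of_bool (j \<in> T') :: bit)" for j
      unfolding ind_def by (rule fun_cong)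
    then show "T = T'" by (auto simp: of_bool_eq_iff)
  qed
  let ?S = "(\<lambda>T. T \<inter> C) ` insert {} (traces G X)"
  have "real (card ?S) \<le> trace_bound r (card C)"
  proof (rule card_r_bounded_family[OF finC _ \<open>2 \<le> r\<close>])
    show "?S \<subseteq> Pow C" by auto
    fix D assume D: "D \<subseteq> C" "card D = r"
    then have "D \<noteq> {}" using \<open>2 \<le> r\<close> by auto
    let ?U = "{u \<in> X. D \<subseteq> outer_nbrs G X u}"
    have "card ?U < r"
    proof (rule ccontr)
      assume "\<not> card ?U < r"
      then have "card D < r"
        using D C(1) X
        by (intro no_Krr_biclique[OF G K, of ?U D]) (auto simp: outer_nbrs_def)
      then show False using D by simp
    qed
    have "{s \<in> ?S. D \<subseteq> s} \<subseteq> (\<lambda>u. outer_nbrs G X u \<inter> C) ` ?U"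
      using \<open>D \<noteq> {}\<close> by (auto simp: traces_def)
    then have "card {s \<in> ?S. D \<subseteq> s} \<le> card ((\<lambda>u. outer_nbrs G X u \<inter> C) ` ?U)"
      using finX by (intro card_mono) auto
    also have "\<dots> \<le> card ?U" using finX by (intro card_image_le) auto
    finally show "card {s \<in> ?S. D \<subseteq> s} \<le> r - 1" using \<open>card ?U < r\<close> by simp
  qed
  also have "\<dots> \<le> trace_bound r k"
    using C(2) rank by (intro trace_bound_mono[OF \<open>2 \<le> r\<close>]) simp
  also have "card ?S = card (insert {} (traces G X))" by (rule card_image[OF inj])
  also have "\<dots> = card (traces G X) + 1"
    using finX by (subst card_insert_disjoint) (auto simp: traces_def)
  finally show ?thesis by simp
qed

section \<open>Trees given by parent pointers\<close>

definition parent_graph :: "nat set \<Rightarrow> nat \<Rightarrow> (nat \<Rightarrow> nat) \<Rightarrow> nat pair_pre_digraph" where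
  "parent_graph N rt parent =
     \<lparr>pverts = N, parcs = (\<Union>i \<in> N - {rt}. {(i, parent i), (parent i, i)})\<rparr>"

lemma closed_walk_nth:
  assumes "pcas u es v" "es \<noteq> []"
  shows "fst (es ! 0) = u" "snd (es ! (length es - 1)) = v"
    "\<And>i. Suc i < length es \<Longrightarrow> snd (es ! i) = fst (es ! Suc i)"
proof -
  have "es \<noteq> [] \<longrightarrow> fst (es ! 0) = u \<and> snd (es ! (length es - 1)) = v \<and>
    (\<forall>i. Suc i < length es \<longrightarrow> snd (es ! i) = fst (es ! Suc i))"
    using assms(1)
  proof (induction es arbitrary: u)
    case (Cons e es)
    then have IH: "es \<noteq> [] \<longrightarrow> fst (es ! 0) = snd e \<and> snd (es ! (length es - 1)) = v \<and>
      (\<forall>i. Suc i < length es \<longrightarrow> snd (es ! i) = fst (es ! Suc i))" and e: "fst e = u"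
      and v: "pcas (snd e) es v"
      by auto
    show ?case
    proof (cases "es = []")
      case True
      then show ?thesis using e v by simp
    next
      case False
      have "snd ((e # es) ! i) = fst ((e # es) ! Suc i)" if "Suc i < length (e # es)" for i
        using that IH False by (cases i) auto
      then show ?thesis using IH False e by (auto simp: nth_Cons' simp del: nth_Cons_Suc)
    qed
  qed simp
  then show "fst (es ! 0) = u" "snd (es ! (length es - 1)) = v"
    "\<And>i. Suc i < length es \<Longrightarrow> snd (es ! i) = fst (es ! Suc i)"
    using assms(2) by auto
qed

text \<open>
  Following parents strictly decreases the node, so every node reaches the only one that has no
  parent among the nodes.
\<close>

lemma connected_by_parents:
  fixes parent :: "nat \<Rightarrow> nat"
  assumes "wf_digraph H" "verts H = N" "apex \<in> N"
    and up: "\<And>i. i \<in> N \<Longrightarrow> i \<noteq> apex \<Longrightarrow> parent i \<in> N \<and> parent i < i \<and> (i, parent i) \<in> arcs_ends H"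
  shows "Digraph_Component.connected H"
proof -
  interpret wf_digraph H by fact
  let ?M = "mk_symmetric H"
  interpret M: pair_wf_digraph ?M by (rule wellformed_mk_symmetric)
  have up': "i \<rightarrow>\<^sup>*\<^bsub>with_proj ?M\<^esub> apex" if "i \<in> N" for i
    using that
  proof (induction i rule: less_induct)
    case (less i)
    show ?case
    proof (cases "i = apex")
      case True
      then show ?thesis using less.prems assms(2) by (simp add: reachable_def)
    next
      case False
      note step = up[OF less.prems False]
      then have "i \<rightarrow>\<^sup>*\<^bsub>H\<^esub> parent i" by (intro reachable_adjI) simp
      then have "i \<rightarrow>\<^sup>*\<^bsub>with_proj ?M\<^esub> parent i" by (rule reachable_mk_symmetricI)
      moreover have "parent i \<rightarrow>\<^sup>*\<^bsub>with_proj ?M\<^esub> apex" using less.IH step by blast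
      ultimately show ?thesis by (rule M.reachable_trans)
    qed
  qed
  have down: "apex \<rightarrow>\<^sup>*\<^bsub>with_proj ?M\<^esub> i" if "i \<in> N" for i
    using symmetric_reachable[OF symmetric_mk_symmetric up'[OF that]] .
  show ?thesis
    unfolding Digraph_Component.connected_def
  proof (rule strongly_connectedI)
    show "verts (with_proj ?M) \<noteq> {}" using assms(2,3) by auto
    fix u v assume "u \<in> verts (with_proj ?M)" "v \<in> verts (with_proj ?M)"
    then have "u \<in> N" "v \<in> N" using assms(2) by simp_all
    then show "u \<rightarrow>\<^sup>*\<^bsub>with_proj ?M\<^esub> v" using up' down M.reachable_trans by blast
  qed
qed

text \<open>
  Numbering parents below their children serves both as a termination argument and to exclude
  cycles: a largest node of a cycle would have two different parents.
\<close>

locale parent_pointers =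
  fixes N :: "nat set" and rt :: nat and parent :: "nat \<Rightarrow> nat"
  assumes finite_nodes: "finite N" and root_node: "rt \<in> N"
    and parent_node: "\<And>i. i \<in> N \<Longrightarrow> i \<noteq> rt \<Longrightarrow> parent i \<in> N"
    and parent_less: "\<And>i. i \<in> N \<Longrightarrow> i \<noteq> rt \<Longrightarrow> parent i < i"
begin

lemma pair_graph_parent_graph: "pair_graph (parent_graph N rt parent)"
proof
  show "finite (parcs (parent_graph N rt parent))"
    using finite_nodes by (auto simp: parent_graph_def)
  show "Digraph.symmetric (with_proj (parent_graph N rt parent))"
    by (auto simp: parent_graph_def symmetric_def intro!: symI)
qed (use finite_nodes in \<open>auto simp: parent_graph_def dest: parent_less intro: parent_node\<close>)

lemma smaller_nbr_is_parent:
  assumes "(i, j) \<in> parcs (parent_graph N rt parent)" "j < i"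
  shows "j = parent i"
  using assms by (auto simp: parent_graph_def dest: parent_less)

lemma undirected_tree_parent_graph: "undirected_tree (parent_graph N rt parent)"
  unfolding undirected_tree_def
proof (intro conjI notI)
  let ?T = "parent_graph N rt parent"
  show "pair_graph ?T" by (rule pair_graph_parent_graph)
  interpret pair_graph ?T by (rule pair_graph_parent_graph)
  show "Digraph_Component.connected (with_proj ?T)"
  proof (rule connected_by_parents[where N = N and apex = rt and parent = parent])
    show "wf_digraph (with_proj ?T)" by unfold_locales
  qed (use root_node parent_node parent_less in \<open>auto simp: parent_graph_def\<close>)
  assume "\<exists>es. pre_digraph.cycle (with_proj ?T) es \<and> 3 \<le> length es"
  then obtain es u where walk: "awalk u es u" and dist: "distinct (tl (awalk_verts u es))"
    and len: "3 \<le> length es"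
    by (auto simp: cycle_def)
  let ?n = "length es"
  have ne: "es \<noteq> []" using len by auto
  have arcs: "set es \<subseteq> parcs ?T" and cas: "pcas u es u" using walk by (auto simp: awalk_def)
  have heads: "distinct (map snd es)"
    using dist ne by (simp add: awalk_verts_conv'[OF cas])
  note walk_nth = closed_walk_nth[OF cas ne]
  have next_arc: "fst (es ! (Suc i mod ?n)) = snd (es ! i)" if "i < ?n" for i
  proof (cases "Suc i = ?n")
    case True
    then show ?thesis using walk_nth(1,2) by (metis diff_Suc_1 mod_self)
  next
    case False
    then show ?thesis using that walk_nth(3)[of i] by simp
  qed
  \<comment> \<open>Both arcs of the cycle at its largest node join this node to its parent.\<close>
  let ?m = "Max (snd ` set es)"
  have "?m \<in> snd ` set es" using ne by (intro Max_in) auto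
  then obtain i where i: "i < ?n" "snd (es ! i) = ?m" by (auto simp: in_set_conv_nth)
  define j where "j = Suc i mod ?n"
  \<comment> \<open>The arcs \<open>j\<close> and \<open>k\<close> follow and precede arc \<open>i\<close>, with indices modulo the length.\<close>
  define k where "k = (if i = 0 then ?n - 1 else i - 1)"
  have "j < ?n" unfolding j_def using len by (intro mod_less_divisor) linarith
  then have jk: "j < ?n" "k < ?n" "Suc k mod ?n = i" using i len by (auto simp: k_def)
  have tail_i: "fst (es ! i) = snd (es ! k)" using next_arc[OF jk(2)] jk(3) by simp
  have tail_j: "fst (es ! j) = ?m" using next_arc[OF i(1)] i(2) by (simp add: j_def)
  have arc: "es ! a \<in> parcs ?T" "snd (es ! a) \<le> ?m" if "a < ?n" for a
    using arcs that by (auto intro!: Max_ge)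
  have "snd (es ! j) = parent ?m"
  proof (rule smaller_nbr_is_parent)
    show "(?m, snd (es ! j)) \<in> parcs ?T" using arc(1)[OF jk(1)] tail_j by (metis prod.collapse)
    then show "snd (es ! j) < ?m" using arc(2)[OF jk(1)] no_loops' by fastforce
  qed
  moreover have "snd (es ! k) = parent ?m"
  proof (rule smaller_nbr_is_parent)
    show "(?m, snd (es ! k)) \<in> parcs ?T"
      using arc(1)[OF i(1)] tail_i i(2) by (metis prod.collapse arcs_symmetric)
    then show "snd (es ! k) < ?m" using arc(2)[OF jk(2)] no_loops' by fastforce
  qed
  ultimately have "j = k"
    using heads jk by (simp add: distinct_conv_nth) metis
  then show False using i len unfolding j_def k_def
    by (cases "Suc i = ?n") (auto split: if_splits)
qed

text \<open>
  Subtrees are recognised by their topmost node, which is how the bags containing a vertex are shown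
  to be connected.
\<close>

lemma connected_induced_by_apex:
  assumes "M \<subseteq> N" "apex \<in> M" "\<And>i. i \<in> M \<Longrightarrow> i \<noteq> apex \<Longrightarrow> i \<noteq> rt \<and> parent i \<in> M"
  shows "Digraph_Component.connected (induce_subgraph (with_proj (parent_graph N rt parent)) M)"
proof -
  interpret pair_graph "parent_graph N rt parent" by (rule pair_graph_parent_graph)
  show ?thesis
  proof (rule connected_by_parents[where N = M and apex = apex and parent = parent])
    fix i assume i: "i \<in> M" "i \<noteq> apex"
    then have "(i, parent i) \<in> parcs (parent_graph N rt parent)"
      using assms(1,3) by (auto simp: parent_graph_def)
    then show "parent i \<in> M \<and> parent i < i \<and>
        (i, parent i) \<in> arcs_ends (induce_subgraph (with_proj (parent_graph N rt parent)) M)"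
      using assms i by (auto simp: arcs_ends_conv parent_less image_iff)
  qed (use assms(2) in auto)
qed

end

section \<open>Bisections and rank-decompositions\<close>

text \<open>
  The sets that can be bisected recursively down to single vertices, such that every set on the way
  has at most \<open>m\<close> traces. This keeps from a rooted rank-decomposition all that is used later.
\<close>

inductive cluster :: "'a pair_pre_digraph \<Rightarrow> nat \<Rightarrow> 'a set \<Rightarrow> bool" for G m where
  single: "v \<in> pverts G \<Longrightarrow> card (traces G {v}) \<le> m \<Longrightarrow> cluster G m {v}"
| union: "cluster G m A \<Longrightarrow> cluster G m B \<Longrightarrow> A \<inter> B = {} \<Longrightarrow> card (traces G (A \<union> B)) \<le> m \<Longrightarrow>
    cluster G m (A \<union> B)"

lemma cluster_subset: "cluster G m X \<Longrightarrow> X \<subseteq> pverts G"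
  by (induction rule: cluster.induct) auto

lemma card_traces_cluster: "cluster G m X \<Longrightarrow> card (traces G X) \<le> m"
  by (auto elim: cluster.cases)

text \<open>
  One of the two components of \<open>del_edge T s t\<close>, in a form suited to induction along walks.
\<close>

definition branch :: "'t pair_pre_digraph \<Rightarrow> 't \<Rightarrow> 't \<Rightarrow> 't set" where
  "branch T s t = {x. (t, x) \<in> (parcs T - {(s, t), (t, s)})\<^sup>*}"

locale tree_graph =
  fixes T :: "'t pair_pre_digraph"
  assumes tree: "undirected_tree T"

sublocale tree_graph \<subseteq> pair_graph T
  using tree by (simp add: undirected_tree_def)

context tree_graph
begin

lemma pair_graph_del_edge: "pair_graph (del_edge T s t)"
proof
  show "Digraph.symmetric (with_proj (del_edge T s t))"
    using arcs_symmetric by (auto simp: del_edge_def symmetric_def intro!: symI)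
qed (use pair_finite_verts pair_finite_arcs no_loops' arc_fst_in_verts arc_snd_in_verts
      in \<open>auto simp: del_edge_def\<close>)

lemma reachable_del_edge:
  assumes "t \<in> pverts T"
  shows "t \<rightarrow>\<^sup>*\<^bsub>with_proj (del_edge T s t)\<^esub> x \<longleftrightarrow> x \<in> branch T s t"
proof -
  interpret D: pair_graph "del_edge T s t" by (rule pair_graph_del_edge)
  have "pverts (del_edge T s t) = pverts T" "parcs (del_edge T s t) = parcs T - {(s, t), (t, s)}"
    by (simp_all add: del_edge_def)
  then show ?thesis
    using D.reachable_conv'[of t x] assms by (simp add: branch_def)
qed

lemma branch_sym:
  assumes "x \<in> branch T s t" shows "(x, t) \<in> (parcs T - {(s, t), (t, s)})\<^sup>*"
proof -
  have "sym (parcs T - {(s, t), (t, s)})" using arcs_symmetric by (auto intro: symI)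
  then show ?thesis using assms unfolding branch_def by (auto dest: sym_rtrancl symD)
qed

lemma branch_component:
  assumes st: "(s, t) \<in> parcs T"
  shows "branch T s t \<in> components (del_edge T s t)"
proof -
  interpret D: pair_graph "del_edge T s t" by (rule pair_graph_del_edge)
  note t = in_arcsD2[OF st]
  note reach = reachable_del_edge[OF t]
  have to_t: "x \<rightarrow>\<^sup>*\<^bsub>with_proj (del_edge T s t)\<^esub> t" if "x \<in> branch T s t" for x
    using that D.symmetric_reachable'[of t x] reach[of s x] by blast
  have "t \<in> branch T s t" by (simp add: branch_def)
  moreover have "x \<rightarrow>\<^sup>*\<^bsub>with_proj (del_edge T s t)\<^esub> y" if "x \<in> branch T s t" "y \<in> branch T s t" for x y
    using D.reachable_trans[OF to_t[OF that(1)]] that(2) reach[of s y] by blast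
  moreover have "y \<in> branch T s t"
    if "x \<in> branch T s t" "x \<rightarrow>\<^sup>*\<^bsub>with_proj (del_edge T s t)\<^esub> y" for x y
    using D.reachable_trans[OF _ that(2), of t] that(1) reach[of s x] reach[of s y] by blast
  ultimately show ?thesis
    unfolding components_def D.in_sccs_verts_conv_reachable by blast
qed

text \<open>
  Every edge of a tree is a bridge: a path from \<open>t\<close> back to \<open>s\<close> avoiding the edge would close to a
  cycle, and it has at least two arcs, so the cycle is not a mere back and forth.
\<close>

lemma not_in_branch:
  assumes st: "(s, t) \<in> parcs T"
  shows "s \<notin> branch T s t"
proof
  assume "s \<in> branch T s t"
  interpret D: pair_graph "del_edge T s t" by (rule pair_graph_del_edge)
  have arcs: "parcs (del_edge T s t) = parcs T - {(s, t), (t, s)}"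
    and verts: "pverts (del_edge T s t) = pverts T"
    by (simp_all add: del_edge_def)
  have "t \<rightarrow>\<^sup>*\<^bsub>with_proj (del_edge T s t)\<^esub> s"
    using \<open>s \<in> branch T s t\<close> reachable_del_edge[OF in_arcsD2[OF st]] by blast
  then obtain p where p: "D.apath t p s" by (auto simp: D.reachable_apath)
  then have walk: "awalk t p s" and dist: "distinct (pawalk_verts t p)"
    and p_arcs: "set p \<subseteq> parcs T - {(s, t), (t, s)}"
    by (auto simp: D.apath_def D.awalk_def awalk_def arcs verts)
  have "length p \<ge> 2"
  proof (rule ccontr)
    assume "\<not> 2 \<le> length p"
    then consider "p = []" | e where "p = [e]"
      by (cases p; cases "tl p") auto
    then show False
    proof cases
      case 1
      then show False using walk no_loops'[OF st] by (simp add: awalk_def)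
    next
      case 2
      then have "e = (t, s)" using walk by (auto simp: awalk_def prod_eq_iff)
      then show False using 2 p_arcs by simp
    qed
  qed
  moreover have "awalk s ((s, t) # p) s"
    using walk st by (simp add: awalk_Cons_iff)
  then have "cycle ((s, t) # p)"
    using dist unfolding cycle_def by (intro exI[of _ s]) auto
  ultimately show False
    using tree unfolding undirected_tree_def by (metis One_nat_def Suc_le_mono length_Cons numeral_2_eq_2 numeral_3_eq_3)
qed

text \<open>
  A walk that leaves \<open>s\<close> through the edge to \<open>t\<close> and does not use this edge again can never return to
  \<open>s\<close>. Deleting the edge and deleting the vertex \<open>s\<close> thus have the same effect on this side.
\<close>

lemma branch_avoiding:
  assumes st: "(s, t) \<in> parcs T" and "x \<in> branch T s t"
  shows "(t, x) \<in> {(x, y) \<in> parcs T. x \<noteq> s \<and> y \<noteq> s}\<^sup>*"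
proof -
  have "(t, x) \<in> (parcs T - {(s, t), (t, s)})\<^sup>*" using assms(2) by (simp add: branch_def)
  then show ?thesis
  proof (induction rule: rtrancl_induct)
    case (step y z)
    have "z \<in> branch T s t" "y \<in> branch T s t"
      using step.hyps unfolding branch_def by (auto intro: rtrancl.rtrancl_into_rtrancl simp del: Diff_iff)
    then have "y \<noteq> s" "z \<noteq> s" using not_in_branch[OF st] by auto
    then have "(y, z) \<in> {(x, y) \<in> parcs T. x \<noteq> s \<and> y \<noteq> s}" using step.hyps by simp
    with step.IH show ?case by (rule rtrancl.rtrancl_into_rtrancl)
  qed simp
qed

text \<open>
  The recursion on a rooted tree: below \<open>t\<close>, seen from \<open>s\<close>, hang the branches of its other
  neighbours. With three neighbours this is the bisection of a cluster.
\<close>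

lemma branch_split:
  assumes st: "(s, t) \<in> parcs T"
  shows "branch T s t = insert t (\<Union>a \<in> {a. (t, a) \<in> parcs T \<and> a \<noteq> s}. branch T t a)"
proof (intro equalityI subsetI)
  fix x assume "x \<in> branch T s t"
  then have "(t, x) \<in> (parcs T - {(s, t), (t, s)})\<^sup>*" by (simp add: branch_def)
  then show "x \<in> insert t (\<Union>a \<in> {a. (t, a) \<in> parcs T \<and> a \<noteq> s}. branch T t a)"
  proof (induction rule: rtrancl_induct)
    case (step y z)
    from step.IH consider "y = t" | a where "(t, a) \<in> parcs T" "a \<noteq> s" "y \<in> branch T t a" by blast
    then show ?case
    proof cases
      case 1
      then have "(t, z) \<in> parcs T" "z \<noteq> s" using step.hyps by auto
      moreover have "z \<in> branch T t z" by (simp add: branch_def)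
      ultimately show ?thesis by blast
    next
      case 2
      have "z = t \<or> z \<in> branch T t a"
      proof (cases "(y, z) \<in> {(t, a), (a, t)}")
        case True
        then show ?thesis by (auto simp: branch_def)
      next
        case False
        then have "(y, z) \<in> parcs T - {(t, a), (a, t)}" using step.hyps by simp
        then show ?thesis using 2(3) unfolding branch_def by (auto intro: rtrancl.rtrancl_into_rtrancl simp del: Diff_iff)
      qed
      then show ?thesis using 2 by blast
    qed
  qed simp
next
  fix x assume "x \<in> insert t (\<Union>a \<in> {a. (t, a) \<in> parcs T \<and> a \<noteq> s}. branch T t a)"
  then consider "x = t" | a where "(t, a) \<in> parcs T" "a \<noteq> s" "x \<in> branch T t a" by blast
  then show "x \<in> branch T s t"
  proof cases
    case 1
    then show ?thesis by (simp add: branch_def)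
  next
    case 2
    have "{(x, y) \<in> parcs T. x \<noteq> t \<and> y \<noteq> t} \<subseteq> parcs T - {(s, t), (t, s)}" by auto
    then have "(a, x) \<in> (parcs T - {(s, t), (t, s)})\<^sup>*"
      using branch_avoiding[OF 2(1,3)] rtrancl_mono by blast
    moreover have "(t, a) \<in> parcs T - {(s, t), (t, s)}" using 2 no_loops'[OF 2(1)] by auto
    ultimately show ?thesis unfolding branch_def by (simp add: converse_rtrancl_into_rtrancl)
  qed
qed

lemma branches_disjoint:
  assumes ta: "(t, a) \<in> parcs T" and tb: "(t, b) \<in> parcs T" and "a \<noteq> b"
  shows "branch T t a \<inter> branch T t b = {}"
proof (rule ccontr)
  let ?W = "{(x, y) \<in> parcs T. x \<noteq> t \<and> y \<noteq> t}"
  assume "branch T t a \<inter> branch T t b \<noteq> {}"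
  then obtain x where x: "x \<in> branch T t a" "x \<in> branch T t b" by blast
  have "sym ?W" using arcs_symmetric by (auto intro: symI)
  then have "(x, b) \<in> ?W\<^sup>*"
    using branch_avoiding[OF tb x(2)] by (auto dest: sym_rtrancl symD)
  moreover have "?W \<subseteq> parcs T - {(t, a), (a, t)}" by auto
  ultimately have "(x, b) \<in> (parcs T - {(t, a), (a, t)})\<^sup>*" using rtrancl_mono by blast
  then have "(a, b) \<in> (parcs T - {(t, a), (a, t)})\<^sup>*" using x(1) by (simp add: branch_def)
  moreover have "(b, t) \<in> parcs T - {(t, a), (a, t)}"
    using arcs_symmetric[OF tb] \<open>a \<noteq> b\<close> no_loops'[OF tb] by auto
  ultimately have "t \<in> branch T t a"
    unfolding branch_def by (auto intro: rtrancl.rtrancl_into_rtrancl simp del: Diff_iff)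
  then show False using not_in_branch[OF ta] by blast
qed

lemma branches_of_edge:
  assumes st: "(s, t) \<in> parcs T"
  shows "branch T s t \<union> branch T t s = pverts T" "branch T s t \<inter> branch T t s = {}"
proof -
  let ?F = "parcs T - {(s, t), (t, s)}"
  have ts: "branch T t s = {x. (s, x) \<in> ?F\<^sup>*}" by (simp add: branch_def insert_commute)
  have in_verts: "x \<in> pverts T" if "(y, x) \<in> ?F\<^sup>*" "y \<in> pverts T" for x y
    using that by (induction rule: rtrancl_induct) (auto dest: in_arcsD2)
  show "branch T s t \<union> branch T t s = pverts T"
  proof (intro equalityI subsetI)
    fix x assume "x \<in> branch T s t \<union> branch T t s"
    then show "x \<in> pverts T"
      using in_verts in_arcsD1[OF st] in_arcsD2[OF st] unfolding ts unfolding branch_def by blast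
  next
    fix x assume "x \<in> pverts T"
    have "Digraph_Component.connected (with_proj T)" using tree by (simp add: undirected_tree_def)
    then have "t \<rightarrow>\<^sup>*\<^bsub>with_proj (mk_symmetric (with_proj T))\<^esub> x"
      using \<open>x \<in> pverts T\<close> in_arcsD2[OF st]
      by (auto simp: Digraph_Component.connected_def strongly_connected_def)
    then have "t \<rightarrow>\<^sup>*\<^bsub>with_proj T\<^esub> x"
      using reachable_mk_symmetric_eq[OF sym_arcs] by simp
    then have "(t, x) \<in> (parcs T)\<^sup>*" by (simp add: reachable_conv)
    then show "x \<in> branch T s t \<union> branch T t s"
    proof (induction rule: rtrancl_induct)
      case base
      show ?case by (simp add: branch_def)
    next
      case (step y z)
      show ?case
      proof (cases "(y, z) \<in> {(s, t), (t, s)}")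
        case True
        then show ?thesis by (auto simp: branch_def)
      next
        case False
        then have "(y, z) \<in> ?F" using step.hyps by simp
        then show ?thesis using step.IH unfolding ts unfolding branch_def
          by (auto intro: rtrancl.rtrancl_into_rtrancl)
      qed
    qed
  qed
  show "branch T s t \<inter> branch T t s = {}"
  proof (rule ccontr)
    assume "branch T s t \<inter> branch T t s \<noteq> {}"
    then obtain x where x: "x \<in> branch T s t" "x \<in> branch T t s" by blast
    have "(x, t) \<in> ?F\<^sup>*" by (rule branch_sym[OF x(1)])
    then have "t \<in> branch T t s" using x(2) by (simp add: ts)
    then show False using not_in_branch[OF arcs_symmetric[OF st]] by blast
  qed
qed

lemma degree_eq: "degree T t = card {a. (t, a) \<in> parcs T}"
proof -
  have "out_arcs (with_proj T) t = Pair t ` {a. (t, a) \<in> parcs T}" by (auto simp: image_iff)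
  then show ?thesis by (simp add: degree_def out_degree_def card_image inj_on_def)
qed

end

text \<open>
  Induction on the size of the branch behind a directed edge. Behind a leaf lies a single vertex;
  behind a node of degree 3 lie two smaller branches, which split the vertices because inner nodes
  do not carry vertices. Finally, the two sides of any edge make up the whole graph.
\<close>

lemma cluster_of_rank_decomposition:
  assumes G: "pair_graph G" and dec: "rank_decomposition G T \<mu>" and two: "2 \<le> card (pverts G)"
    and m: "\<And>s t C. (s, t) \<in> parcs T \<Longrightarrow> C \<in> components (del_edge T s t) \<Longrightarrow>
      card (traces G {v \<in> pverts G. \<mu> v \<in> C}) \<le> m"
  shows "cluster G m (pverts G)"
proof -
  interpret tree_graph T
    using dec by (simp add: tree_graph_def rank_decomposition_def ternary_tree_def)
  define X where "X s t = {v \<in> pverts G. \<mu> v \<in> branch T s t}" for s t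
  have inj: "inj_on \<mu> (pverts G)" and image: "\<mu> ` pverts G = leaves T"
    using dec by (simp_all add: rank_decomposition_def bij_betw_def)
  have deg: "degree T t = 1 \<or> degree T t = 3" if "t \<in> pverts T" for t
    using dec that by (auto simp: rank_decomposition_def ternary_tree_def)
  have traces: "card (traces G (X s t)) \<le> m" if "(s, t) \<in> parcs T" for s t
    unfolding X_def by (rule m[OF that branch_component[OF that]])
  have cluster: "cluster G m (X s t)" if "(s, t) \<in> parcs T" for s t
    using that
  proof (induction "card (branch T s t)" arbitrary: s t rule: less_induct)
    case less
    let ?N = "{a. (t, a) \<in> parcs T}"
    have t: "t \<in> pverts T" and s: "s \<in> ?N"
      using less.prems in_arcsD2 arcs_symmetric by auto
    have fin: "finite (branch T s t)"
      using branches_of_edge(1)[OF less.prems] pair_finite_verts by (metis finite_Un)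
    show ?case
    proof (cases "degree T t = 1")
      case True
      then obtain s' where s': "?N = {s'}" by (auto simp: degree_eq card_1_singleton_iff)
      have "s = s'" using s unfolding s' by simp
      then have "?N = {s}" using s' by simp
      then have "{a. (t, a) \<in> parcs T \<and> a \<noteq> s} = {}" by blast
      then have branch: "branch T s t = {t}"
        using branch_split[OF less.prems] by (simp only: UN_empty)
      have "t \<in> leaves T" using t True by (simp add: leaves_def)
      then have "t \<in> \<mu> ` pverts G" using image by simp
      then obtain v where v: "v \<in> pverts G" "\<mu> v = t" by blast
      have "u = v" if "u \<in> pverts G" "\<mu> u = t" for u
        using inj_onD[OF inj, of u v] that v by simp
      then have "X s t = {v}" using v unfolding X_def branch by blast
      then show ?thesis using cluster.single[OF v(1)] traces[OF less.prems] by simp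
    next
      case False
      then have "card ?N = 3" using deg[OF t] by (simp add: degree_eq)
      then have "card (?N - {s}) = 2" using s by (simp add: card_Diff_singleton)
      then obtain a b where "?N - {s} = {a, b}" "a \<noteq> b" by (auto simp: card_2_iff)
      then have ab: "{a'. (t, a') \<in> parcs T \<and> a' \<noteq> s} = {a, b}" by auto
      then have ta: "(t, a) \<in> parcs T" and tb: "(t, b) \<in> parcs T" by blast+
      have branch: "branch T s t = insert t (branch T t a \<union> branch T t b)"
        using branch_split[OF less.prems] unfolding ab by simp
      have "card (branch T t a) < card (branch T s t)"
        using not_in_branch[OF ta] fin unfolding branch by (intro psubset_card_mono) auto
      note IHa = less.hyps[OF this ta]
      have "card (branch T t b) < card (branch T s t)"
        using not_in_branch[OF tb] fin unfolding branch by (intro psubset_card_mono) auto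
      note IHb = less.hyps[OF this tb]
      have "t \<notin> leaves T" using False by (simp add: leaves_def)
      then have "\<mu> v \<noteq> t" if "v \<in> pverts G" for v using image that by blast
      then have X: "X s t = X t a \<union> X t b" unfolding X_def branch by blast
      have "X t a \<inter> X t b = {}"
        using branches_disjoint[OF ta tb \<open>a \<noteq> b\<close>] by (auto simp: X_def)
      then show ?thesis
        using cluster.union[OF IHa IHb] traces[OF less.prems] X by simp
    qed
  qed
  obtain v where v: "v \<in> pverts G" using two by fastforce
  then have "\<mu> v \<in> leaves T" using image by blast
  then have "card {a. (\<mu> v, a) \<in> parcs T} = 1" by (simp add: leaves_def degree_eq)
  then obtain s where st: "(\<mu> v, s) \<in> parcs T" by (auto simp: card_1_singleton_iff)
  let ?t = "\<mu> v"
  have leaf: "\<mu> u \<in> pverts T" if "u \<in> pverts G" for u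
    using image that by (auto simp: leaves_def)
  have "pverts G = X ?t s \<union> X s ?t"
    using branches_of_edge(1)[OF st] leaf by (auto simp: X_def)
  moreover have "X ?t s \<inter> X s ?t = {}"
    using branches_of_edge(2)[OF st] by (auto simp: X_def)
  moreover have "traces G (pverts G) = {}" by (auto simp: traces_def outer_nbrs_def)
  ultimately show ?thesis
    using cluster.union[OF cluster[OF st] cluster[OF arcs_symmetric[OF st]]] by simp
qed

text \<open>
  Without this lemma the least width in the definition of rank-width might be taken over the empty
  set. The decomposition is a caterpillar: its spine consists of the odd nodes \<open>1, 3, 5, \<dots>\<close>, the
  first of which has the parent 0, and node \<open>2 * j - 1\<close> has the children \<open>2 * j\<close> and \<open>2 * j + 1\<close>.
  Its leaves are the even nodes and the last odd node.
\<close>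

lemma ex_rank_decomposition:
  assumes "2 \<le> card (pverts G)"
  shows "\<exists>(T :: nat pair_pre_digraph) \<mu>. rank_decomposition G T \<mu>"
proof -
  obtain k where k: "card (pverts G) = k + 2"
    using assms by (auto simp: le_iff_add)
  define N where "N = {0..<2 * k + 2}"
  \<comment> \<open>Truncated subtraction makes 0 the parent of 1.\<close>
  define p where "p i = 2 * (i div 2) - 1" for i :: nat
  define T where "T = parent_graph N 0 p"
  have p_less: "p i < i" if "i \<noteq> 0" for i
  proof -
    have "2 * (i div 2) \<le> i" by simp
    then show ?thesis using that unfolding p_def by linarith
  qed
  interpret parent_pointers N 0 p
  proof
    fix i assume "i \<in> N" "i \<noteq> 0"
    then show "p i \<in> N" using p_less[of i] by (simp add: N_def)
  qed (simp_all add: N_def p_less)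
  interpret tree_graph T
    by unfold_locales (simp add: T_def undirected_tree_parent_graph)
  have verts: "pverts T = N" by (simp add: T_def parent_graph_def)
  have deg: "degree T t = (if even t \<or> t = 2 * k + 1 then 1 else 3)" if t: "t \<in> N" for t
  proof -
    define Ch where "Ch = {i \<in> N - {0}. p i = t}"
    have "{a. (t, a) \<in> parcs T} = (if t = 0 then {} else {p t}) \<union> Ch"
      using t by (auto simp: T_def parent_graph_def Ch_def)
    then have deg: "degree T t = card ((if t = 0 then {} else {p t}) \<union> Ch)"
      by (simp only: degree_eq)
    have mem: "i \<in> Ch \<longleftrightarrow> i < 2 * k + 2 \<and> i \<noteq> 0 \<and> 2 * (i div 2) - 1 = t" for i
      by (auto simp: Ch_def N_def p_def)
    have t: "t < 2 * k + 2" using t by (simp add: N_def)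
    have half: "\<exists>q. i div 2 = q \<and> (i = 2 * q \<or> i = 2 * q + 1)" for i :: nat
      by (cases "even i") simp_all
    consider "t = 0" | "even t" "t \<noteq> 0" | "t = 2 * k + 1" | "odd t" "t \<noteq> 2 * k + 1" by blast
    then show ?thesis
    proof cases
      case 1
      have "i \<in> Ch \<longleftrightarrow> i = 1" for i
      proof -
        obtain q where q: "i div 2 = q" "i = 2 * q \<or> i = 2 * q + 1" using half by blast
        show ?thesis unfolding mem 1 q(1) using q(2) by auto
      qed
      then have "Ch = {1}" by blast
      then show ?thesis using 1 deg by simp
    next
      case 2
      obtain j where j: "t = 2 * j" using 2(1) by (elim evenE)
      have "i \<notin> Ch" for i
      proof -
        obtain q where q: "i div 2 = q" "i = 2 * q \<or> i = 2 * q + 1" using half by blast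
        have "2 * q - 1 \<noteq> 2 * j" using 2(2) j by presburger
        then show ?thesis unfolding mem j q(1) by blast
      qed
      then have "Ch = {}" by blast
      then show ?thesis using 2 deg by simp
    next
      case 3
      have "i \<notin> Ch" for i
      proof -
        obtain q where q: "i div 2 = q" "i = 2 * q \<or> i = 2 * q + 1" using half by blast
        show ?thesis unfolding mem 3 q(1) using q(2) by auto
      qed
      then have "Ch = {}" by blast
      then show ?thesis using 3 deg by simp
    next
      case 4
      obtain j where j: "t = 2 * j + 1" using 4(1) by (elim oddE)
      have lt: "2 * j + 3 < 2 * k + 2" using t 4(2) unfolding j by presburger
      have eq: "2 * (i div 2) - 1 = t \<longleftrightarrow> i = t + 1 \<or> i = t + 2" for i
      proof -
        obtain q where q: "i div 2 = q" "i = 2 * q \<or> i = 2 * q + 1" using half by blast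
        have "2 * q - 1 = 2 * j + 1 \<longleftrightarrow> q = j + 1" by presburger
        then show ?thesis unfolding j q(1) using q(2) by presburger
      qed
      have "i \<in> Ch \<longleftrightarrow> i = t + 1 \<or> i = t + 2" for i
        unfolding mem eq using lt unfolding j by auto
      then have "Ch = {t + 1, t + 2}" by blast
      moreover have "t \<noteq> 0" by (simp add: j)
      moreover have "p t < t" using p_less[OF \<open>t \<noteq> 0\<close>] .
      ultimately show ?thesis using 4 deg by simp
    qed
  qed
  have "leaves T = {t \<in> N. degree T t = 1}" by (simp only: leaves_def verts)
  also have "\<dots> = {t \<in> N. even t \<or> t = 2 * k + 1}"
    using deg by (auto split: if_splits)
  also have "\<dots> = (\<lambda>j. 2 * j) ` {..k} \<union> {2 * k + 1}"
    by (auto simp: N_def elim!: evenE)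
  finally have leaves: "leaves T = (\<lambda>j. 2 * j) ` {..k} \<union> {2 * k + 1}" .
  have "2 * k + 1 \<notin> (\<lambda>j. 2 * j) ` {..k}" by auto
  then have "card (leaves T) = card (pverts G)"
    by (simp add: leaves k card_image inj_on_def)
  moreover have "finite (pverts G)" using assms by (auto intro: card_ge_0_finite)
  moreover have "finite (leaves T)" by (simp add: leaves)
  ultimately obtain \<mu> where "bij_betw \<mu> (pverts G) (leaves T)"
    using finite_same_card_bij by metis
  moreover have "ternary_tree T"
    unfolding ternary_tree_def verts using tree deg by auto
  ultimately show ?thesis unfolding rank_decomposition_def by blast
qed

section \<open>Clique-width of a bisected graph\<close>

text \<open>
  Agreement of the labels only on the vertices makes the notion independent of the junk labels
  elsewhere, on which the values of expressions do depend.
\<close>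

definition builds :: "nat \<Rightarrow> 'a pair_pre_digraph \<Rightarrow> ('a \<Rightarrow> nat) \<Rightarrow> bool" where
  "builds k H lab \<longleftrightarrow>
     (\<exists>e lab'. is_kexp k e \<and> kexp_value e H lab' \<and> (\<forall>v \<in> pverts H. lab' v = lab v))"

lemma clique_width_le: "builds k G lab \<Longrightarrow> clique_width G \<le> k"
  unfolding clique_width_def builds_def by (auto intro!: Least_le)

lemma builds_cong: "builds k H lab \<Longrightarrow> (\<And>v. v \<in> pverts H \<Longrightarrow> lab v = lab' v) \<Longrightarrow> builds k H lab'"
  unfolding builds_def by fastforce

lemma builds_vertex:
  "lab v \<in> {1..k} \<Longrightarrow> builds k \<lparr>pverts = {v}, parcs = {}\<rparr> lab"
  unfolding builds_def by (intro exI[of _ "Vertex (lab v)"] exI[of _ lab]) (auto intro: kexp_value.vertex)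

lemma builds_relabel:
  assumes "builds k H lab" "i \<in> {1..k}" "j \<in> {1..k}" "i \<noteq> j"
  shows "builds k H (\<lambda>v. if lab v = i then j else lab v)"
proof -
  obtain e lab' where e: "is_kexp k e" "kexp_value e H lab'" "\<forall>v \<in> pverts H. lab' v = lab v"
    using assms(1) by (auto simp: builds_def)
  have "kexp_value (Relabel i j e) H (\<lambda>v. if lab' v = i then j else lab' v)"
    by (rule kexp_value.relabel[OF e(2)])
  moreover have "is_kexp k (Relabel i j e)" using e(1) assms by simp
  ultimately show ?thesis unfolding builds_def using e(3) by fastforce
qed

lemma builds_join:
  assumes "builds k H lab" "i \<in> {1..k}" "j \<in> {1..k}" "i \<noteq> j"
  shows "builds k \<lparr>pverts = pverts H, parcs = parcs H \<union>
    {(u, v) \<in> pverts H \<times> pverts H. (lab u = i \<and> lab v = j) \<or> (lab u = j \<and> lab v = i)}\<rparr> lab"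
proof -
  obtain e lab' where e: "is_kexp k e" "kexp_value e H lab'" "\<forall>v \<in> pverts H. lab' v = lab v"
    using assms(1) by (auto simp: builds_def)
  have "{(u, v) \<in> pverts H \<times> pverts H. (lab' u = i \<and> lab' v = j) \<or> (lab' u = j \<and> lab' v = i)} =
    {(u, v) \<in> pverts H \<times> pverts H. (lab u = i \<and> lab v = j) \<or> (lab u = j \<and> lab v = i)}"
    using e(3) by auto
  then have "kexp_value (Join i j e) \<lparr>pverts = pverts H, parcs = parcs H \<union>
    {(u, v) \<in> pverts H \<times> pverts H. (lab u = i \<and> lab v = j) \<or> (lab u = j \<and> lab v = i)}\<rparr> lab'"
    using kexp_value.join[OF e(2), of i j] by simp
  moreover have "is_kexp k (Join i j e)" using e(1) assms by simp
  ultimately show ?thesis unfolding builds_def using e(3) by fastforce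
qed

lemma builds_disj_union:
  assumes "builds k H1 lab" "builds k H2 lab" "pverts H1 \<inter> pverts H2 = {}"
  shows "builds k \<lparr>pverts = pverts H1 \<union> pverts H2, parcs = parcs H1 \<union> parcs H2\<rparr> lab"
proof -
  obtain e1 lab1 where e1: "is_kexp k e1" "kexp_value e1 H1 lab1" "\<forall>v \<in> pverts H1. lab1 v = lab v"
    using assms(1) by (auto simp: builds_def)
  obtain e2 lab2 where e2: "is_kexp k e2" "kexp_value e2 H2 lab2" "\<forall>v \<in> pverts H2. lab2 v = lab v"
    using assms(2) by (auto simp: builds_def)
  have "kexp_value (DisjUnion e1 e2)
      \<lparr>pverts = pverts H1 \<union> pverts H2, parcs = parcs H1 \<union> parcs H2\<rparr> lab"
    using e1 e2 assms(3) by (intro kexp_value.disj_union[of e1 H1 lab1 e2 H2 lab2]) auto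
  moreover have "is_kexp k (DisjUnion e1 e2)" using e1(1) e2(1) by simp
  ultimately show ?thesis unfolding builds_def by blast
qed

text \<open>
  The operation \<open>\<eta>\<close> does not depend on edges added before, so joins can be carried out one after the
  other.
\<close>

lemma builds_joins:
  assumes "builds k H lab" "finite J" "J \<subseteq> {1..k} \<times> {1..k}" "\<And>i. (i, i) \<notin> J"
  shows "builds k \<lparr>pverts = pverts H, parcs = parcs H \<union>
    {(u, v) \<in> pverts H \<times> pverts H. (lab u, lab v) \<in> J \<or> (lab v, lab u) \<in> J}\<rparr> lab"
  using assms(2-)
proof (induction J)
  case empty
  then show ?case using assms(1) by (cases H) simp
next
  case (insert p J)
  obtain i j where p: "p = (i, j)" by fastforce
  have ij: "i \<in> {1..k}" "j \<in> {1..k}" "i \<noteq> j" using insert.prems p by auto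
  have "builds k \<lparr>pverts = pverts H, parcs = parcs H \<union>
    {(u, v) \<in> pverts H \<times> pverts H. (lab u, lab v) \<in> J \<or> (lab v, lab u) \<in> J}\<rparr> lab"
    using insert by auto
  note step = builds_join[OF this ij]
  have "parcs H \<union> {(u, v) \<in> pverts H \<times> pverts H. (lab u, lab v) \<in> J \<or> (lab v, lab u) \<in> J} \<union>
      {(u, v) \<in> pverts H \<times> pverts H. (lab u = i \<and> lab v = j) \<or> (lab u = j \<and> lab v = i)} =
    parcs H \<union>
      {(u, v) \<in> pverts H \<times> pverts H. (lab u, lab v) \<in> insert p J \<or> (lab v, lab u) \<in> insert p J}"
    unfolding p by auto
  then show ?case using step by simp
qed

text \<open>
  No label in \<open>S\<close> is the target of a relabelling, hence the order of the single steps does not matter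
  and no spare label is needed for swapping.
\<close>

lemma builds_relabels:
  assumes "builds k H lab" "finite S" "S \<subseteq> {1..k}" "\<And>i. i \<in> S \<Longrightarrow> g i \<in> {1..k}"
    and "\<And>i. i \<in> S \<Longrightarrow> g i \<notin> S"
  shows "builds k H (\<lambda>v. if lab v \<in> S then g (lab v) else lab v)"
  using assms(2-)
proof (induction S)
  case empty
  then show ?case using assms(1) by simp
next
  case (insert i S)
  have "builds k H (\<lambda>v. if lab v \<in> S then g (lab v) else lab v)"
    using insert by auto
  moreover have "i \<in> {1..k}" "g i \<in> {1..k}" "i \<noteq> g i"
    using insert.prems(1) insert.prems(2,3)[of i] by auto
  ultimately have "builds k H (\<lambda>v. if (if lab v \<in> S then g (lab v) else lab v) = i then g i
      else (if lab v \<in> S then g (lab v) else lab v))"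
    by (rule builds_relabel)
  then show ?case
  proof (rule builds_cong)
    fix v
    show "(if (if lab v \<in> S then g (lab v) else lab v) = i then g i
        else (if lab v \<in> S then g (lab v) else lab v)) =
      (if lab v \<in> insert i S then g (lab v) else lab v)"
      using insert.prems(3)[of "lab v"] insert.hyps by auto
  qed
qed

lemma extend_injection:
  assumes "finite D" "finite F" "card D \<le> card F" "R \<subseteq> D" "inj_on h R" "h ` R \<subseteq> F"
  obtains h' where "inj_on h' D" "h' ` D \<subseteq> F" "\<And>x. x \<in> R \<Longrightarrow> h' x = h x"
proof -
  have "finite R" using assms(1,4) finite_subset by blast
  then have "card (D - R) \<le> card (F - h ` R)"
    using assms by (simp add: card_Diff_subset card_image)
  then obtain q where q: "q ` (D - R) \<subseteq> F - h ` R" "inj_on q (D - R)"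
    using card_le_inj[of "D - R" "F - h ` R"] assms(1,2) by auto
  define h' where "h' x = (if x \<in> R then h x else q x)" for x
  show thesis
  proof (rule that)
    show "inj_on h' D"
    proof (rule inj_onI)
      fix x y assume xy: "x \<in> D" "y \<in> D" "h' x = h' y"
      have "h x \<noteq> q y" if "x \<in> R" "y \<in> D - R" for x y using that q(1) by blast
      then show "x = y"
        using xy inj_onD[OF assms(5)] inj_onD[OF q(2)]
        by (cases "x \<in> R"; cases "y \<in> R") (auto simp: h'_def dest: sym)
    qed
    show "h' ` D \<subseteq> F" using q(1) assms(6) by (auto simp: h'_def)
  qed (simp add: h'_def)
qed

definition induced :: "'a pair_pre_digraph \<Rightarrow> 'a set \<Rightarrow> 'a pair_pre_digraph" where
  "induced G X = \<lparr>pverts = X, parcs = parcs G \<inter> X \<times> X\<rparr>"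

text \<open>
  The label \<open>z\<close> is shared by all vertices without neighbours outside \<open>X\<close>, to which no later join
  applies.
\<close>

definition trace_label :: "'a pair_pre_digraph \<Rightarrow> 'a set \<Rightarrow> nat \<Rightarrow> ('a set \<Rightarrow> nat) \<Rightarrow> 'a \<Rightarrow> nat" where
  "trace_label G X z f v = (if outer_nbrs G X v = {} then z else f (outer_nbrs G X v))"

text \<open>
  The claim holds for every injective labelling \<open>f\<close> of the traces of the union, and the induction
  hypotheses are applied to labellings of the two parts that are adapted to \<open>f\<close>: with each trace \<open>T\<close>
  of the union, one of the classes that are merged into the class of \<open>T\<close> already carries the label
  \<open>f T\<close>. The remaining classes get unused labels, of which there are enough because the two parts have
  at most \<open>2 * m\<close> traces in total. So the final relabelling only moves labels to targets that stay
  fixed.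
\<close>

lemma builds_union:
  fixes m :: nat
  assumes G: "pair_graph G" and sub: "A \<subseteq> pverts G" "B \<subseteq> pverts G" and disj: "A \<inter> B = {}"
    and IHA: "\<And>f. inj_on f (traces G A) \<Longrightarrow> f ` traces G A \<subseteq> {1..2 * m} \<Longrightarrow>
      builds (2 * m + 1) (induced G A) (trace_label G A (2 * m + 1) f)"
    and IHB: "\<And>f. inj_on f (traces G B) \<Longrightarrow> f ` traces G B \<subseteq> {1..2 * m} \<Longrightarrow>
      builds (2 * m + 1) (induced G B) (trace_label G B (2 * m + 1) f)"
    and m: "card (traces G A) \<le> m" "card (traces G B) \<le> m"
    and f: "inj_on f (traces G (A \<union> B))" "f ` traces G (A \<union> B) \<subseteq> {1..2 * m}"
  shows "builds (2 * m + 1) (induced G (A \<union> B)) (trace_label G (A \<union> B) (2 * m + 1) f)"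
proof -
  interpret pair_graph G by (rule G)
  let ?Z = "A \<union> B" and ?k = "2 * m + 1"
  have fin: "finite A" "finite B" using sub pair_finite_verts finite_subset by blast+
  then have fin_traces: "finite (traces G A)" "finite (traces G B)" by (auto simp: traces_def)
  \<comment> \<open>The classes of both parts; the tag is necessary since both parts may have a trace in common.\<close>
  define key where
    "key u = (if u \<in> A then (True, outer_nbrs G A u) else (False, outer_nbrs G B u))" for u
  have row: "outer_nbrs G ?Z u = snd (key u) - ?Z" if "u \<in> ?Z" for u
  proof (cases "u \<in> A")
    case True
    then show ?thesis by (simp add: key_def outer_nbrs_superset[of A ?Z G u])
  next
    case False
    then show ?thesis by (simp add: key_def outer_nbrs_superset[of B ?Z G u])
  qed
  define D where "D = {True} \<times> traces G A \<union> {False} \<times> traces G B"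
  have key_D: "key u \<in> D" if "u \<in> ?Z" "snd (key u) \<noteq> {}" for u
    using that by (auto simp: D_def key_def traces_def split: if_splits)
  have snd_D: "snd c \<noteq> {}" if "c \<in> D" for c using that by (auto simp: D_def traces_def)
  have D_key: "\<exists>u \<in> ?Z. key u = c" if c: "c \<in> D" for c
  proof -
    obtain u where "u \<in> A \<and> c = (True, outer_nbrs G A u) \<or> u \<in> B \<and> c = (False, outer_nbrs G B u)"
      using c by (auto simp: D_def traces_def)
    then show ?thesis using disj by (intro bexI[of _ u]) (auto simp: key_def)
  qed
  have finD: "finite D" using fin_traces by (simp add: D_def)
  have "card D = card (traces G A) + card (traces G B)"
    unfolding D_def using fin_traces by (subst card_Un_disjoint) (auto simp: card_cartesian_product)
  then have card_D: "card D \<le> card {1..2 * m}" using m by simp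
  \<comment> \<open>Every class of the union keeps the label of one of the classes merged into it.\<close>
  have "\<forall>T \<in> traces G ?Z. \<exists>c. c \<in> D \<and> snd c - ?Z = T"
  proof
    fix T assume "T \<in> traces G ?Z"
    then obtain u where u: "u \<in> ?Z" "T = outer_nbrs G ?Z u" "T \<noteq> {}" by (auto simp: traces_def)
    then have "key u \<in> D" "snd (key u) - ?Z = T" using row[OF u(1)] key_D[OF u(1)] by auto
    then show "\<exists>c. c \<in> D \<and> snd c - ?Z = T" by blast
  qed
  then obtain rep where rep: "\<And>T. T \<in> traces G ?Z \<Longrightarrow> rep T \<in> D"
    "\<And>T. T \<in> traces G ?Z \<Longrightarrow> snd (rep T) - ?Z = T"
    by metis
  obtain h where h: "inj_on h D" "h ` D \<subseteq> {1..2 * m}"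
    and "\<And>c. c \<in> rep ` traces G ?Z \<Longrightarrow> h c = f (snd c - ?Z)"
  proof (rule extend_injection[OF finD finite_atLeastAtMost card_D,
        of "rep ` traces G ?Z" "\<lambda>c. f (snd c - ?Z)"])
    show "inj_on (\<lambda>c. f (snd c - ?Z)) (rep ` traces G ?Z)"
      using f(1) rep(2) by (auto simp: inj_on_def)
  qed (use rep f in auto)
  then have h_rep: "h (rep T) = f T" if "T \<in> traces G ?Z" for T
    using rep(2)[OF that] that by simp
  define l where "l v = (if snd (key v) = {} then ?k else h (key v))" for v
  have l_range: "l v \<in> {1..?k}" if "v \<in> ?Z" for v
    using key_D[OF that] h(2) by (cases "snd (key v) = {}") (auto simp: l_def image_subset_iff)
  have l_inj: "key u = key v" if "u \<in> ?Z" "v \<in> ?Z" "l u = l v" "snd (key u) \<noteq> {}" for u v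
  proof -
    have "l u \<in> {1..2 * m}" using key_D[OF that(1,4)] h(2) that(4) by (auto simp: l_def)
    then have "snd (key v) \<noteq> {}" using that(3) by (auto simp: l_def)
    then show ?thesis
      using that key_D inj_onD[OF h(1), of "key u" "key v"] by (simp add: l_def)
  qed
  have "builds ?k (induced G A) l"
  proof (rule builds_cong)
    show "builds ?k (induced G A) (trace_label G A ?k (\<lambda>T. h (True, T)))"
    proof (rule IHA)
      show "inj_on (\<lambda>T. h (True, T)) (traces G A)"
        using h(1) by (auto simp: inj_on_def D_def)
      show "(\<lambda>T. h (True, T)) ` traces G A \<subseteq> {1..2 * m}" using h(2) by (auto simp: D_def)
    qed
  qed (auto simp: trace_label_def l_def key_def induced_def)
  moreover have "builds ?k (induced G B) l"
  proof (rule builds_cong)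
    show "builds ?k (induced G B) (trace_label G B ?k (\<lambda>T. h (False, T)))"
    proof (rule IHB)
      show "inj_on (\<lambda>T. h (False, T)) (traces G B)"
        using h(1) by (auto simp: inj_on_def D_def)
      show "(\<lambda>T. h (False, T)) ` traces G B \<subseteq> {1..2 * m}" using h(2) by (auto simp: D_def)
    qed
    fix v assume "v \<in> pverts (induced G B)"
    then have "v \<notin> A" using disj by (auto simp: induced_def)
    then show "trace_label G B ?k (\<lambda>T. h (False, T)) v = l v"
      by (auto simp: trace_label_def l_def key_def)
  qed
  ultimately have un: "builds ?k \<lparr>pverts = ?Z, parcs = parcs G \<inter> A \<times> A \<union> parcs G \<inter> B \<times> B\<rparr> l"
    using builds_disj_union[of ?k "induced G A" l "induced G B"] disj by (simp add: induced_def)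
  define J where "J = (\<lambda>(a, b). (l a, l b)) ` (parcs G \<inter> A \<times> B)"
  have cross: "b \<in> outer_nbrs G A a \<and> a \<in> outer_nbrs G B b" if "(a, b) \<in> parcs G" "a \<in> A" "b \<in> B" for a b
    using that sub disj arcs_symmetric by (auto simp: outer_nbrs_def)
  have key_A: "key a = (True, outer_nbrs G A a)" if "a \<in> A" for a using that by (simp add: key_def)
  have key_B: "key b = (False, outer_nbrs G B b)" if "b \<in> B" for b
    using that disj by (auto simp: key_def)
  have join: "(u, v) \<in> parcs G \<and> u \<in> A \<and> v \<in> B" if "(l u, l v) \<in> J" "u \<in> ?Z" "v \<in> ?Z" for u v
  proof -
    obtain a b where ab: "(a, b) \<in> parcs G" "a \<in> A" "b \<in> B" "l u = l a" "l v = l b"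
      using \<open>(l u, l v) \<in> J\<close> by (auto simp: J_def)
    note c = cross[OF ab(1-3)]
    have "key a = key u"
      by (rule l_inj) (use ab that c key_A[OF ab(2)] in auto)
    then have u: "u \<in> A" "outer_nbrs G A u = outer_nbrs G A a"
      using key_A[OF ab(2)] by (auto simp: key_def split: if_splits)
    have "key b = key v"
      by (rule l_inj) (use ab that c key_B[OF ab(3)] in auto)
    then have v: "v \<notin> A" "outer_nbrs G B v = outer_nbrs G B b"
      using key_B[OF ab(3)] by (auto simp: key_def split: if_splits)
    then have "v \<in> B" using that by blast
    have "b \<in> outer_nbrs G A u" using c u by simp
    then have "(u, b) \<in> parcs G" by (simp add: outer_nbrs_def)
    then have "u \<in> outer_nbrs G B v" using cross[of u b] u v ab(3) by simp
    then have "(v, u) \<in> parcs G" by (simp add: outer_nbrs_def)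
    then show ?thesis using arcs_symmetric u \<open>v \<in> B\<close> by blast
  qed
  have "builds ?k \<lparr>pverts = ?Z, parcs = parcs G \<inter> A \<times> A \<union> parcs G \<inter> B \<times> B \<union>
    {(u, v) \<in> ?Z \<times> ?Z. (l u, l v) \<in> J \<or> (l v, l u) \<in> J}\<rparr> l"
  proof -
    have "finite J" using pair_finite_arcs by (simp add: J_def)
    moreover have "J \<subseteq> {1..?k} \<times> {1..?k}" using l_range by (auto simp: J_def simp del: atLeastAtMost_iff)
    moreover have "(i, i) \<notin> J" for i
    proof
      assume "(i, i) \<in> J"
      then obtain a b where ab: "(a, b) \<in> parcs G" "a \<in> A" "b \<in> B" "l a = l b"
        by (auto simp: J_def)
      have "key a = key b"
        by (rule l_inj) (use ab cross[OF ab(1-3)] key_A[OF ab(2)] in auto)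
      then show False using key_A key_B ab by simp
    qed
    ultimately show ?thesis using builds_joins[OF un] by simp
  qed
  also have "\<lparr>pverts = ?Z, parcs = parcs G \<inter> A \<times> A \<union> parcs G \<inter> B \<times> B \<union>
    {(u, v) \<in> ?Z \<times> ?Z. (l u, l v) \<in> J \<or> (l v, l u) \<in> J}\<rparr> = induced G ?Z"
  proof -
    have J: "(l u, l v) \<in> J" if "(u, v) \<in> parcs G" "u \<in> A" "v \<in> B" for u v
      using that by (auto simp: J_def)
    have "parcs G \<inter> A \<times> A \<union> parcs G \<inter> B \<times> B \<union>
        {(u, v) \<in> ?Z \<times> ?Z. (l u, l v) \<in> J \<or> (l v, l u) \<in> J} = parcs G \<inter> ?Z \<times> ?Z"
      (is "?L = ?R")
    proof (intro equalityI subsetI)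
      fix e assume e: "e \<in> ?L"
      obtain u v where uv: "e = (u, v)" by fastforce
      show "e \<in> ?R"
      proof (cases "u \<in> ?Z \<and> v \<in> ?Z \<and> ((l u, l v) \<in> J \<or> (l v, l u) \<in> J)")
        case True
        then have "(u, v) \<in> parcs G"
          using join[of u v] join[of v u] arcs_symmetric[of v u] by argo
        then show ?thesis using True uv by simp
      qed (use e uv in auto)
    next
      fix e assume e: "e \<in> ?R"
      obtain u v where uv: "e = (u, v)" by fastforce
      have "(l u, l v) \<in> J" if "u \<in> A" "v \<in> B" using J that e uv by simp
      moreover have "(l v, l u) \<in> J" if "v \<in> A" "u \<in> B" using J arcs_symmetric that e uv by simp
      ultimately show "e \<in> ?L" using e uv by auto
    qed
    then show ?thesis by (simp add: induced_def)
  qed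
  finally have ind: "builds ?k (induced G ?Z) l" .
  \<comment> \<open>The final label of a class, and the labels that have to be changed.\<close>
  define tgt where "tgt c = (if snd c - ?Z = {} then ?k else f (snd c - ?Z))" for c :: "bool \<times> 'a set"
  define S where "S = {h c | c. c \<in> D \<and> h c \<noteq> tgt c}"
  let ?g = "\<lambda>i. tgt (inv_into D h i)"
  have trace_D: "snd c - ?Z \<in> traces G ?Z" if c: "c \<in> D" "snd c - ?Z \<noteq> {}" for c
  proof -
    obtain u where u: "u \<in> ?Z" "key u = c" using D_key[OF c(1)] by blast
    then have "snd c - ?Z = outer_nbrs G ?Z u" using row by simp
    then show ?thesis using u(1) c(2) by (simp add: traces_def)
  qed
  have tgt_range: "tgt c \<in> {1..?k}" if "c \<in> D" for c
  proof (cases "snd c - ?Z = {}")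
    case False
    then have "f (snd c - ?Z) \<in> {1..2 * m}" using trace_D[OF that] f(2) by blast
    then show ?thesis using False by (simp add: tgt_def)
  qed (simp add: tgt_def)
  have tgt_fixed: "tgt c \<notin> S" if "c \<in> D" for c
  proof (cases "snd c - ?Z = {}")
    case True
    then show ?thesis using h(2) by (auto simp: tgt_def S_def image_subset_iff)
  next
    case False
    let ?T = "snd c - ?Z"
    note T = trace_D[OF that False]
    have "tgt c = h (rep ?T)" using False h_rep[OF T] by (simp add: tgt_def)
    moreover have "tgt (rep ?T) = h (rep ?T)"
      using False h_rep[OF T] rep(2)[OF T] by (simp add: tgt_def)
    moreover have "d = rep ?T" if "d \<in> D" "h d = h (rep ?T)" for d
      using inj_onD[OF h(1) that(2,1) rep(1)[OF T]] .
    ultimately show ?thesis by (auto simp: S_def)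
  qed
  have "builds ?k (induced G ?Z) (\<lambda>v. if l v \<in> S then ?g (l v) else l v)"
  proof (rule builds_relabels[OF ind])
    have "S \<subseteq> h ` D" by (auto simp: S_def)
    moreover have "h ` D \<subseteq> {1..?k}" using h(2) by fastforce
    ultimately show "finite S" "S \<subseteq> {1..?k}"
      using finD finite_subset[of S "h ` D"] by auto
    fix i assume "i \<in> S"
    then have "inv_into D h i \<in> D" by (auto simp: S_def intro: inv_into_into)
    then show "?g i \<in> {1..?k}" "?g i \<notin> S" using tgt_range tgt_fixed by blast+
  qed
  then show ?thesis
  proof (rule builds_cong)
    fix v assume "v \<in> pverts (induced G ?Z)"
    then have v: "v \<in> ?Z" by (simp add: induced_def)
    have goal: "trace_label G ?Z ?k f v = tgt (key v)"
      using row[OF v] by (simp add: trace_label_def tgt_def)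
    show "(if l v \<in> S then ?g (l v) else l v) = trace_label G ?Z ?k f v"
    proof (cases "snd (key v) = {}")
      case True
      then have "l v = ?k" "tgt (key v) = ?k" by (simp_all add: l_def tgt_def)
      moreover have "?k \<notin> S" using h(2) by (auto simp: S_def image_subset_iff)
      ultimately show ?thesis using goal by simp
    next
      case False
      then have lv: "l v = h (key v)" and D: "key v \<in> D" using key_D[OF v] by (simp_all add: l_def)
      have inv: "inv_into D h (l v) = key v" using lv D h(1) by simp
      show ?thesis
      proof (cases "l v \<in> S")
        case True
        then show ?thesis using inv goal by simp
      next
        case False
        then have "h (key v) = tgt (key v)" using lv D unfolding S_def by blast
        then show ?thesis using False lv goal by simp
      qed
    qed
  qed
qed

lemma builds_cluster:
  assumes G: "pair_graph G" and "cluster G m X"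
    and "inj_on f (traces G X)" "f ` traces G X \<subseteq> {1..2 * m}"
  shows "builds (2 * m + 1) (induced G X) (trace_label G X (2 * m + 1) f)"
  using assms(2-)
proof (induction arbitrary: f rule: cluster.induct)
  case (single v)
  interpret pair_graph G by (rule G)
  have "induced G {v} = \<lparr>pverts = {v}, parcs = {}\<rparr>"
    using no_loops' by (auto simp: induced_def)
  moreover have "trace_label G {v} (2 * m + 1) f v \<in> {1..2 * m + 1}"
  proof (cases "outer_nbrs G {v} v = {}")
    case False
    then have "outer_nbrs G {v} v \<in> traces G {v}" by (simp add: traces_def)
    then have "f (outer_nbrs G {v} v) \<in> {1..2 * m}" using single.prems(2) by blast
    then show ?thesis using False by (simp add: trace_label_def)
  qed (simp add: trace_label_def)
  ultimately show ?case by (simp add: builds_vertex)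
next
  case (union A B)
  show ?case
    by (rule builds_union[OF G cluster_subset[OF union.hyps(1)] cluster_subset[OF union.hyps(2)]
          union.hyps(3) union.IH card_traces_cluster[OF union.hyps(1)]
          card_traces_cluster[OF union.hyps(2)] union.prems])
qed

lemma clique_width_le_cluster:
  assumes G: "pair_graph G" and "cluster G m (pverts G)"
  shows "clique_width G \<le> 2 * m + 1"
proof -
  interpret pair_graph G by (rule G)
  have "traces G (pverts G) = {}" by (auto simp: traces_def outer_nbrs_def)
  then have "builds (2 * m + 1) (induced G (pverts G)) (trace_label G (pverts G) (2 * m + 1) f)" for f
    using assms by (intro builds_cluster) auto
  moreover have "induced G (pverts G) = G"
    unfolding induced_def using in_arcsD1 in_arcsD2 by (cases G) auto
  ultimately show ?thesis using clique_width_le by metis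
qed

section \<open>Tree-width of a bisected graph\<close>

definition twins :: "'a pair_pre_digraph \<Rightarrow> 'a set \<Rightarrow> 'a \<Rightarrow> 'a set" where
  "twins G X u = {w \<in> X. outer_nbrs G X w = outer_nbrs G X u}"

text \<open>
  These vertices are put into bags themselves; the other ones with outside neighbours are
  represented by those neighbours.
\<close>

definition small :: "nat \<Rightarrow> 'a pair_pre_digraph \<Rightarrow> 'a set \<Rightarrow> 'a set" where
  "small r G X = {u \<in> X. outer_nbrs G X u \<noteq> {} \<and> card (twins G X u) < r}"

text \<open>
  A vertex cover of the edges leaving \<open>X\<close>. Unlike an arbitrary small vertex cover, it depends
  monotonically on \<open>X\<close>, which makes the bags fit together.
\<close>

definition cover :: "nat \<Rightarrow> 'a pair_pre_digraph \<Rightarrow> 'a set \<Rightarrow> 'a set" where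
  "cover r G X = small r G X \<union> (\<Union>u \<in> {u \<in> X. r \<le> card (twins G X u)}. outer_nbrs G X u)"

lemma card_twins_mono:
  assumes "X \<subseteq> Y" "finite Y"
  shows "card (twins G X u) \<le> card (twins G Y u)"
  using assms by (intro card_mono) (auto simp: twins_def outer_nbrs_superset)

text \<open>
  Twins with respect to \<open>X\<close> are twins with respect to every larger set, so classes only grow while
  their traces shrink.
\<close>

lemma small_antimono:
  assumes "X \<subseteq> Y" "finite Y"
  shows "small r G Y \<inter> X \<subseteq> small r G X"
proof
  fix u assume u: "u \<in> small r G Y \<inter> X"
  then have "card (twins G X u) < r"
    using card_twins_mono[OF assms, of G u] by (auto simp: small_def)
  then show "u \<in> small r G X"
    using u by (auto simp: small_def outer_nbrs_superset[OF assms(1)])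
qed

lemma cover_mono:
  assumes "X \<subseteq> Y" "finite Y"
  shows "cover r G X - Y \<subseteq> cover r G Y"
proof
  fix v assume v: "v \<in> cover r G X - Y"
  then obtain u where u: "u \<in> X" "r \<le> card (twins G X u)" "v \<in> outer_nbrs G X u"
    using assms(1) by (auto simp: cover_def small_def)
  then have "r \<le> card (twins G Y u)" "v \<in> outer_nbrs G Y u" "u \<in> Y"
    using card_twins_mono[OF assms, of G u] outer_nbrs_superset[OF assms(1), of G u] v assms(1) by auto
  then show "v \<in> cover r G Y" by (auto simp: cover_def)
qed

lemma cover_covers_crossing_edge:
  assumes "u \<in> X" "v \<in> outer_nbrs G X u" "u \<notin> cover r G X"
  shows "v \<in> cover r G X"
  using assms by (force simp: cover_def small_def)

text \<open>
  A vertex \<open>v\<close> in the cover of a set disjoint from \<open>A\<close> is adjacent to all vertices of a large class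
  there. If the class of \<open>v\<close> in \<open>A\<close> were large as well, then the two classes would span a \<open>K\<^bsub>r,r\<^esub>\<close>,
  because twins of \<open>v\<close> have the same neighbours outside \<open>A\<close>. This ties the bags in which \<open>v\<close>
  covers from the outside to those in which it covers from the inside.
\<close>

lemma small_if_in_disjoint_cover:
  assumes G: "pair_graph G" and K: "\<not> has_Krr_subgraph r G"
    and "A \<inter> B = {}" "A \<subseteq> pverts G" "B \<subseteq> pverts G" "v \<in> A" "v \<in> cover r G B"
  shows "v \<in> small r G A"
proof -
  interpret pair_graph G by (rule G)
  obtain u where u: "u \<in> B" "r \<le> card (twins G B u)" "v \<in> outer_nbrs G B u"
    using assms by (auto simp: cover_def small_def)
  have nbrs: "w \<in> outer_nbrs G A v" if "w \<in> twins G B u" for w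
    using that u assms by (auto simp: twins_def outer_nbrs_def intro: arcs_symmetric)
  then have "u \<in> outer_nbrs G A v" using u(1) by (simp add: twins_def)
  moreover have "card (twins G A v) < r"
  proof (rule no_Krr_biclique[OF G K _ _ _ _ u(2)])
    have "w \<in> outer_nbrs G A x" if "w \<in> twins G B u" "x \<in> twins G A v" for w x
      using nbrs that by (auto simp: twins_def)
    then show "twins G B u \<times> twins G A v \<subseteq> parcs G"
      by (auto simp: outer_nbrs_def intro: arcs_symmetric)
  qed (use assms in \<open>auto simp: twins_def\<close>)
  ultimately show ?thesis using \<open>v \<in> A\<close> by (auto simp: small_def)
qed

text \<open>
  Each trace contributes either its class or itself, and by the exclusion of \<open>K\<^bsub>r,r\<^esub>\<close> the chosen one
  has fewer than \<open>r\<close> elements.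
\<close>

lemma card_cover_le:
  assumes G: "pair_graph G" and K: "\<not> has_Krr_subgraph r G"
    and X: "X \<subseteq> pverts G" and m: "card (traces G X) \<le> m"
  shows "card (cover r G X) \<le> m * (r - 1)"
proof -
  interpret pair_graph G by (rule G)
  have finX: "finite X" using X pair_finite_verts by (rule finite_subset)
  define cls where "cls T = {w \<in> X. outer_nbrs G X w = T}" for T
  define cov where "cov T = (if card (cls T) < r then cls T else T)" for T
  have card_cov: "card (cov T) \<le> r - 1" if "T \<in> traces G X" for T
  proof (cases "card (cls T) < r")
    case False
    have "T \<subseteq> pverts G - X" using that by (auto simp: traces_def outer_nbrs_def)
    then have "card T < r" using False X
      by (intro no_Krr_biclique[OF G K, of "cls T"]) (auto simp: cls_def outer_nbrs_def)
    then show ?thesis using False by (simp add: cov_def)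
  qed (simp add: cov_def)
  have "cover r G X \<subseteq> (\<Union>T \<in> traces G X. cov T)"
  proof
    fix v assume "v \<in> cover r G X"
    then consider "v \<in> small r G X"
      | u where "u \<in> X" "r \<le> card (twins G X u)" "v \<in> outer_nbrs G X u"
      by (auto simp: cover_def)
    then show "v \<in> (\<Union>T \<in> traces G X. cov T)"
    proof cases
      case 1
      then show ?thesis
        by (intro UN_I[of "outer_nbrs G X v"])
          (auto simp: small_def traces_def cov_def cls_def twins_def)
    next
      case 2
      then show ?thesis
        by (intro UN_I[of "outer_nbrs G X u"])
          (auto simp: traces_def cov_def cls_def twins_def)
    qed
  qed
  moreover have "finite (\<Union>T \<in> traces G X. cov T)"
  proof -
    have "cov T \<subseteq> pverts G" if "T \<in> traces G X" for T
      using that X by (auto simp: cov_def cls_def traces_def outer_nbrs_def split: if_splits)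
    then show ?thesis using pair_finite_verts by (meson UN_least finite_subset)
  qed
  ultimately have "card (cover r G X) \<le> card (\<Union>T \<in> traces G X. cov T)"
    by (rule card_mono[rotated])
  also have "\<dots> \<le> (\<Sum>T \<in> traces G X. card (cov T))"
    using finX by (intro card_UN_le) (simp add: traces_def)
  also have "\<dots> \<le> card (traces G X) * (r - 1)"
    using sum_bounded_above[of "traces G X" "\<lambda>T. card (cov T)" "r - 1"] card_cov by simp
  also have "\<dots> \<le> m * (r - 1)" using m by simp
  finally show ?thesis .
qed

text \<open>
  The tree of the decomposition is numbered like a binary heap: the root is 1, and the children of
  \<open>n\<close> are \<open>2 * n\<close> and \<open>2 * n + 1\<close>, so that the parent of \<open>i\<close> is \<open>i div 2\<close>.
\<close>

definition descendants :: "nat \<Rightarrow> nat set" where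
  "descendants n = {i. \<exists>d. i div 2 ^ d = n}"

lemma self_descendant: "n \<in> descendants n"
  unfolding descendants_def by (rule CollectI, rule exI[of _ 0]) simp

lemma descendants_ge: "i \<in> descendants n \<Longrightarrow> n \<le> i"
  by (auto simp: descendants_def)

lemma child_descendants:
  assumes "n = c div 2" shows "descendants c \<subseteq> descendants n"
proof
  fix i assume "i \<in> descendants c"
  then obtain d where "i div 2 ^ d = c" by (auto simp: descendants_def)
  then have "i div 2 ^ (Suc d) = n" using assms by (simp only: power_Suc2 div_mult2_eq)
  then show "i \<in> descendants n" unfolding descendants_def by blast
qed

lemma children_disjoint:
  assumes "1 \<le> n" shows "descendants (2 * n) \<inter> descendants (2 * n + 1) = {}"
proof (rule ccontr)
  assume "descendants (2 * n) \<inter> descendants (2 * n + 1) \<noteq> {}"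
  then obtain i a b where a: "i div 2 ^ a = 2 * n" and b: "i div 2 ^ b = 2 * n + 1"
    by (auto simp: descendants_def)
  have shift: "i div 2 ^ (k + l) = i div 2 ^ k div 2 ^ l" for k l
    by (simp only: power_add div_mult2_eq)
  show False
  proof (cases "a \<le> b")
    case True
    then obtain d where "b = a + d" by (auto simp: le_iff_add)
    then have "i div 2 ^ b = 2 * n div 2 ^ d" by (simp only: shift a)
    then have "i div 2 ^ b \<le> 2 * n" by (simp only: div_le_dividend)
    then show False using b by linarith
  next
    case False
    then obtain d where "a = b + Suc d" using less_imp_Suc_add[of b a] by auto
    then have "i div 2 ^ a = (2 * n + 1) div 2 ^ Suc d" by (simp only: shift b)
    also have "\<dots> = (2 * n + 1) div 2 div 2 ^ d" by (simp only: power_Suc div_mult2_eq)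
    also have "(2 * n + 1) div 2 = n" by simp
    also have "n div 2 ^ d \<le> n" by (rule div_le_dividend)
    finally show False using a assms by linarith
  qed
qed

text \<open>
  What the part of the tree decomposition below node \<open>n\<close>, which belongs to the cluster \<open>X\<close>, must
  satisfy. A vertex of \<open>X\<close> occurs in bags forming a nonempty subtree with topmost node \<open>t\<close>. The bags
  containing a vertex outside \<open>X\<close> extend up to \<open>n\<close>, and by the bound on the bags
  such a vertex belongs to the cover of \<open>X\<close>. Concerning an edge \<open>(u, v)\<close> that leaves \<open>X\<close>, either
  \<open>u\<close> is still in the cover, and a bag for the edge can be found further up, or a bag below \<open>n\<close>
  already contains both ends.
\<close>

locale partial_decomposition =
  fixes w r :: nat and G :: "'a pair_pre_digraph" and X :: "'a set" and n :: nat
    and N :: "nat set" and B :: "nat \<Rightarrow> 'a set"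
  assumes finite_nodes: "finite N" and apex_node: "n \<in> N" and nodes_sub: "N \<subseteq> descendants n"
    and parent_node: "\<And>i. i \<in> N \<Longrightarrow> i \<noteq> n \<Longrightarrow> i div 2 \<in> N"
    and bag_sub: "\<And>i. i \<in> N \<Longrightarrow> B i \<subseteq> X \<union> cover r G X"
    and card_bag: "\<And>i. i \<in> N \<Longrightarrow> card (B i) \<le> w"
    and cover_sub: "cover r G X \<subseteq> B n"
    and inner_vertex: "\<And>v. v \<in> X \<Longrightarrow> \<exists>t \<in> N. v \<in> B t \<and>
      (\<forall>i \<in> N. v \<in> B i \<longrightarrow> i \<noteq> t \<longrightarrow> i \<noteq> n \<and> v \<in> B (i div 2))"
    and outer_vertex: "\<And>v i. v \<notin> X \<Longrightarrow> i \<in> N \<Longrightarrow> v \<in> B i \<Longrightarrow> i \<noteq> n \<Longrightarrow> v \<in> B (i div 2)"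
    and edge_in_bag: "\<And>u v. (u, v) \<in> parcs G \<Longrightarrow> u \<in> X \<Longrightarrow> v \<in> X \<or> u \<notin> cover r G X \<Longrightarrow>
      \<exists>i \<in> N. u \<in> B i \<and> v \<in> B i"

lemma partial_decomposition_single:
  assumes G: "pair_graph G" and "2 \<le> r" "1 \<le> w"
  shows "partial_decomposition w r G {v} n {n} (\<lambda>_. {v})"
proof -
  interpret pair_graph G by (rule G)
  have twins: "twins G {v} v = {v}" by (auto simp: twins_def)
  have "small r G {v} = (if outer_nbrs G {v} v = {} then {} else {v})"
    using \<open>2 \<le> r\<close> twins by (auto simp: small_def)
  moreover have "{u \<in> {v}. r \<le> card (twins G {v} u)} = {}"
    using \<open>2 \<le> r\<close> twins by auto
  ultimately have cover: "cover r G {v} = (if outer_nbrs G {v} v = {} then {} else {v})"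
    unfolding cover_def by (simp only: UN_empty Un_empty_right)
  have "u \<in> outer_nbrs G {v} v" if "(v, u) \<in> parcs G" for u
    using that in_arcsD2[OF that] no_loops'[OF that] by (auto simp: outer_nbrs_def)
  note crossing = this
  show ?thesis
  proof
    show "cover r G {v} \<subseteq> {v}" using cover by simp
    show "\<exists>i \<in> {n}. u \<in> {v} \<and> u' \<in> {v}"
      if "(u, u') \<in> parcs G" "u \<in> {v}" "u' \<in> {v} \<or> u \<notin> cover r G {v}" for u u'
      using that crossing[of u'] no_loops'[of v u'] cover by (auto split: if_splits)
  qed (use \<open>1 \<le> w\<close> self_descendant[of n] in simp_all)
qed

text \<open>
  The new bag consists of the three covers at the node. For a vertex \<open>v\<close> of the part \<open>X\<close> that is in
  the new bag, the subtree inside \<open>X\<close> must reach the root of the decomposition of \<open>X\<close>, that is, \<open>v\<close>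
  must lie in the cover of \<open>X\<close>. This follows from antimonotonicity of small classes if \<open>v\<close> is in the
  cover of the union, and from the exclusion of \<open>K\<^bsub>r,r\<^esub>\<close> if it is in the cover of the other part.
\<close>

lemma partial_decomposition_union:
  assumes G: "pair_graph G" and K: "\<not> has_Krr_subgraph r G"
    and XY: "X \<inter> Y = {}" "X \<subseteq> pverts G" "Y \<subseteq> pverts G"
    and m: "card (traces G X) \<le> m" "card (traces G Y) \<le> m" "card (traces G (X \<union> Y)) \<le> m"
    and w: "3 * m * (r - 1) \<le> w" and n: "1 \<le> n"
    and PX: "partial_decomposition w r G X (2 * n) M B"
    and PY: "partial_decomposition w r G Y (2 * n + 1) N C"
  shows "\<exists>B. partial_decomposition w r G (X \<union> Y) n (insert n (M \<union> N)) B"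
proof -
  interpret pair_graph G by (rule G)
  let ?Z = "X \<union> Y"
  define bag where "bag = cover r G X \<union> cover r G Y \<union> cover r G ?Z"
  define D where "D i = (if i = n then bag else if i \<in> M then B i else C i)" for i
  interpret PX: partial_decomposition w r G X "2 * n" M B by (rule PX)
  interpret PY: partial_decomposition w r G Y "2 * n + 1" N C by (rule PY)
  have finZ: "finite ?Z" using XY pair_finite_verts by (meson Un_least finite_subset)
  have nM: "n \<notin> M" using PX.nodes_sub descendants_ge[of n "2 * n"] n by auto
  have nN: "n \<notin> N" using PY.nodes_sub descendants_ge[of n "2 * n + 1"] n by auto
  have MN: "M \<inter> N = {}" using PX.nodes_sub PY.nodes_sub children_disjoint[OF n] by blast
  have DX: "D i = B i" if "i \<in> M" for i using that nM by (auto simp: D_def)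
  have DY: "D i = C i" if "i \<in> N" for i using that nN MN by (auto simp: D_def)
  have Dn: "D n = bag" by (simp add: D_def)
  have card_bag: "card bag \<le> w"
  proof -
    have "card bag \<le> card (cover r G X) + card (cover r G Y) + card (cover r G ?Z)"
      unfolding bag_def by (meson add_mono card_Un_le le_refl order_trans)
    also have "\<dots> \<le> m * (r - 1) + m * (r - 1) + m * (r - 1)"
      using XY m by (intro add_mono card_cover_le[OF G K]) auto
    finally show ?thesis using w by simp
  qed
  have bag_sub: "bag \<subseteq> ?Z \<union> cover r G ?Z"
    using cover_mono[of X ?Z r G] cover_mono[of Y ?Z r G] finZ by (auto simp: bag_def)
  \<comment> \<open>The roles of the two parts are symmetric; everything is shown for the first one only.\<close>
  have half:
    "\<And>v. v \<in> X1 \<Longrightarrow> \<exists>t \<in> insert n (M \<union> N). v \<in> D t \<and>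
        (\<forall>i \<in> insert n (M \<union> N). v \<in> D i \<longrightarrow> i \<noteq> t \<longrightarrow> i \<noteq> n \<and> v \<in> D (i div 2))"
    "\<And>v i. v \<notin> ?Z \<Longrightarrow> i \<in> M1 \<Longrightarrow> v \<in> D i \<Longrightarrow> v \<in> D (i div 2)"
    "\<And>u v. (u, v) \<in> parcs G \<Longrightarrow> u \<in> X1 \<Longrightarrow> v \<in> ?Z \<or> u \<notin> cover r G ?Z \<Longrightarrow>
        \<exists>i \<in> insert n (M \<union> N). u \<in> D i \<and> v \<in> D i"
    "\<And>i. i \<in> M1 \<Longrightarrow> D i \<subseteq> ?Z \<union> cover r G ?Z \<and> card (D i) \<le> w"
    if P1: "partial_decomposition w r G X1 c1 M1 B1"
      and P2: "partial_decomposition w r G X2 c2 M2 B2"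
      and Z: "?Z = X1 \<union> X2" "X1 \<inter> X2 = {}" and MM: "M \<union> N = M1 \<union> M2"
      and bag: "bag = cover r G X1 \<union> cover r G X2 \<union> cover r G ?Z"
      and c: "c1 div 2 = n" "c2 div 2 = n"
      and D1: "\<And>i. i \<in> M1 \<Longrightarrow> D i = B1 i" and D2: "\<And>i. i \<in> M2 \<Longrightarrow> D i = B2 i"
      and n12: "n \<notin> M1" "n \<notin> M2"
    for X1 X2 c1 c2 M1 M2 B1 B2
  proof -
    interpret P1: partial_decomposition w r G X1 c1 M1 B1 by (rule P1)
    interpret P2: partial_decomposition w r G X2 c2 M2 B2 by (rule P2)
    have sub: "X1 \<subseteq> pverts G" "X2 \<subseteq> pverts G" using XY Z by auto
    have in_bag: "v \<in> cover r G X1" if "v \<in> X1" "v \<in> bag" for v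
    proof -
      have "v \<in> small r G X1" if "v \<in> cover r G X2"
        by (rule small_if_in_disjoint_cover[OF G K Z(2) sub \<open>v \<in> X1\<close> that])
      moreover have "v \<in> small r G X1" if "v \<in> cover r G ?Z"
      proof -
        have "v \<in> small r G ?Z"
          using that \<open>v \<in> X1\<close> Z(1) by (auto simp: cover_def outer_nbrs_def)
        then show ?thesis
          using small_antimono[of X1 ?Z r G] finZ \<open>v \<in> X1\<close> Z(1) by blast
      qed
      ultimately show ?thesis using that(2) bag by (auto simp: cover_def)
    qed
    have up1: "i div 2 \<in> M1 \<and> D (i div 2) = B1 (i div 2)" if "i \<in> M1" "i \<noteq> c1" for i
      using P1.parent_node D1 that by simp
    have up2: "i div 2 \<in> M2 \<and> D (i div 2) = B2 (i div 2)" if "i \<in> M2" "i \<noteq> c2" for i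
      using P2.parent_node D2 that by simp
    have out1: "v \<in> D (i div 2)" if "v \<notin> X1" "i \<in> M1" "v \<in> D i" for v i
    proof (cases "i = c1")
      case True
      have "v \<in> cover r G X1" using P1.bag_sub D1 that by blast
      then show ?thesis using True c bag Dn by auto
    next
      case False
      have "v \<in> B1 (i div 2)" using P1.outer_vertex D1 that False by blast
      then show ?thesis using up1 that False by auto
    qed
    have out2: "v \<in> D (i div 2) \<and> v \<in> bag" if "v \<notin> X2" "i \<in> M2" "v \<in> D i" for v i
    proof -
      have cov: "v \<in> cover r G X2" using P2.bag_sub D2 that by blast
      show ?thesis
      proof (cases "i = c2")
        case True
        then show ?thesis using cov c bag Dn by auto
      next
        case False
        have "v \<in> B2 (i div 2)" using P2.outer_vertex D2 that False by blast
        then show ?thesis using up2 that False cov bag by auto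
      qed
    qed
    show "\<exists>t \<in> insert n (M \<union> N). v \<in> D t \<and>
        (\<forall>i \<in> insert n (M \<union> N). v \<in> D i \<longrightarrow> i \<noteq> t \<longrightarrow> i \<noteq> n \<and> v \<in> D (i div 2))"
      if v: "v \<in> X1" for v
    proof -
      have "v \<notin> X2" using v Z(2) by blast
      obtain t where t: "t \<in> M1" "v \<in> B1 t"
        and top: "\<And>i. i \<in> M1 \<Longrightarrow> v \<in> B1 i \<Longrightarrow> i \<noteq> t \<Longrightarrow> i \<noteq> c1 \<and> v \<in> B1 (i div 2)"
        using P1.inner_vertex[OF v] by blast
      show ?thesis
      proof (cases "v \<in> bag")
        case True
        then have "v \<in> B1 c1" using in_bag[OF v] P1.cover_sub by blast
        then have "t = c1" using top[of c1] P1.apex_node by blast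
        have "v \<in> D (i div 2)" if "i \<in> M1" "v \<in> D i" for i
        proof (cases "i = c1")
          case True
          then show ?thesis using c Dn \<open>v \<in> bag\<close> by simp
        next
          case False
          then show ?thesis using top[of i] that \<open>t = c1\<close> D1 up1 by auto
        qed
        then show ?thesis
          using True Dn out2[OF \<open>v \<notin> X2\<close>] MM by (intro bexI[of _ n]) auto
      next
        case False
        have "i \<noteq> n \<and> v \<in> D (i div 2)" if "i \<in> M1" "v \<in> D i" "i \<noteq> t" for i
          using top[of i] that D1 up1 n12 by auto
        moreover have "v \<notin> D i" if "i \<in> M2" for i
          using out2[OF \<open>v \<notin> X2\<close> that] False by blast
        ultimately show ?thesis
          using False Dn t D1 MM by (intro bexI[of _ t]) auto
      qed
    qed
    show "\<exists>i \<in> insert n (M \<union> N). u \<in> D i \<and> v \<in> D i"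
      if uv: "(u, v) \<in> parcs G" "u \<in> X1" "v \<in> ?Z \<or> u \<notin> cover r G ?Z" for u v
    proof -
      have inner1: ?thesis if in1: "v \<in> X1 \<or> u \<notin> cover r G X1"
      proof -
        obtain i where "i \<in> M1" "u \<in> B1 i" "v \<in> B1 i" using P1.edge_in_bag[OF uv(1,2) in1] by blast
        then show ?thesis using D1 MM by (intro bexI[of _ i]) auto
      qed
      have inner2: ?thesis if in2: "v \<in> X2" "v \<notin> cover r G X2"
      proof -
        obtain i where "i \<in> M2" "v \<in> B2 i" "u \<in> B2 i"
          using P2.edge_in_bag[OF arcs_symmetric[OF uv(1)] in2(1)] in2(2) by blast
        then show ?thesis using D2 MM by (intro bexI[of _ i]) auto
      qed
      have outgoing: ?thesis if "u \<in> cover r G X1" "v \<notin> ?Z"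
      proof -
        have "v \<in> cover r G ?Z"
          using uv that Z(1) in_arcsD2[OF uv(1)]
          by (intro cover_covers_crossing_edge[of u]) (auto simp: outer_nbrs_def)
        then show ?thesis using that bag Dn by auto
      qed
      show ?thesis
        using inner1 inner2 outgoing bag Dn Z(1) by blast
    qed
    show "D i \<subseteq> ?Z \<union> cover r G ?Z \<and> card (D i) \<le> w" if "i \<in> M1" for i
    proof -
      have "D i \<subseteq> X1 \<union> cover r G X1" "card (D i) \<le> w" using P1.bag_sub P1.card_bag D1 that by auto
      then show ?thesis using cover_mono[of X1 ?Z r G] finZ Z(1) by blast
    qed
    show "v \<in> D (i div 2)" if "v \<notin> ?Z" "i \<in> M1" "v \<in> D i" for v i
      using out1 that Z(1) by blast
  qed
  note hX = half[OF PX PY refl XY(1) refl bag_def _ _ DX DY nM nN]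
  have "Y \<union> X = ?Z" "Y \<inter> X = {}" "M \<union> N = N \<union> M"
    "bag = cover r G Y \<union> cover r G X \<union> cover r G ?Z"
    using XY(1) by (auto simp: bag_def)
  note hY = half[OF PY PX this(1)[symmetric] this(2,3,4) _ _ DY DX nN nM]
  have sub: "insert n (M \<union> N) \<subseteq> descendants n"
    using PX.nodes_sub PY.nodes_sub child_descendants[of n "2 * n"] child_descendants[of n "2 * n + 1"]
      self_descendant[of n] by auto
  have parent: "i div 2 \<in> insert n (M \<union> N)" if "i \<in> M \<union> N" for i
  proof (cases "i = 2 * n \<or> i = 2 * n + 1")
    case False
    then show ?thesis using that PX.parent_node PY.parent_node by blast
  qed auto
  have c: "2 * n div 2 = n" "(2 * n + 1) div 2 = n" by simp_all
  note hX = hX[OF c] and hY = hY[OF c(2,1)]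
  have "partial_decomposition w r G ?Z n (insert n (M \<union> N)) D"
  proof
    show "finite (insert n (M \<union> N))" using PX.finite_nodes PY.finite_nodes by simp
    show "i div 2 \<in> insert n (M \<union> N)" if "i \<in> insert n (M \<union> N)" "i \<noteq> n" for i
      using parent that by blast
    show "D i \<subseteq> ?Z \<union> cover r G ?Z" "card (D i) \<le> w" if "i \<in> insert n (M \<union> N)" for i
      using that bag_sub card_bag Dn hX(4) hY(4) by blast+
    show "\<exists>t \<in> insert n (M \<union> N). v \<in> D t \<and>
        (\<forall>i \<in> insert n (M \<union> N). v \<in> D i \<longrightarrow> i \<noteq> t \<longrightarrow> i \<noteq> n \<and> v \<in> D (i div 2))"
      if "v \<in> ?Z" for v
      using that hX(1) hY(1) by blast
    show "v \<in> D (i div 2)" if "v \<notin> ?Z" "i \<in> insert n (M \<union> N)" "v \<in> D i" "i \<noteq> n" for v i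
      using that hX(2) hY(2) by blast
    show "\<exists>i \<in> insert n (M \<union> N). u \<in> D i \<and> v \<in> D i"
      if "(u, v) \<in> parcs G" "u \<in> ?Z" "v \<in> ?Z \<or> u \<notin> cover r G ?Z" for u v
      using that hX(3) hY(3) by blast
  qed (use sub Dn bag_def in auto)
  then show ?thesis by blast
qed

lemma cluster_partial_decomposition:
  assumes G: "pair_graph G" and K: "\<not> has_Krr_subgraph r G" and r: "2 \<le> r"
    and w: "1 \<le> w" "3 * m * (r - 1) \<le> w"
    and "cluster G m X" "1 \<le> n"
  shows "\<exists>N B. partial_decomposition w r G X n N B"
  using assms(6,7)
proof (induction arbitrary: n rule: cluster.induct)
  case (single v)
  then show ?case using partial_decomposition_single[OF G r w(1)] by blast
next
  case (union X Y)
  obtain M B where "partial_decomposition w r G X (2 * n) M B"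
    using union.IH(1)[of "2 * n"] union.prems by auto
  moreover obtain N C where "partial_decomposition w r G Y (2 * n + 1) N C"
    using union.IH(2)[of "2 * n + 1"] by auto
  ultimately show ?case
    using partial_decomposition_union[OF G K union.hyps(3)
        cluster_subset[OF union.hyps(1)] cluster_subset[OF union.hyps(2)]
        card_traces_cluster[OF union.hyps(1)] card_traces_cluster[OF union.hyps(2)]
        union.hyps(4) w(2) union.prems]
    by blast
qed

lemma tree_width_le:
  assumes "tree_decomposition G (T :: nat pair_pre_digraph) B" "\<And>t. t \<in> pverts T \<Longrightarrow> card (B t) \<le> w"
  shows "tree_width G + 1 \<le> int w"
proof -
  interpret T: pair_graph T
    using assms(1) by (simp add: tree_decomposition_def undirected_tree_def)
  have "Digraph_Component.connected (with_proj T)"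
    using assms(1) by (simp add: tree_decomposition_def undirected_tree_def)
  then have T: "pverts T \<noteq> {}"
    by (simp add: Digraph_Component.connected_def strongly_connected_def)
  have "tree_width G + 1 \<le> int (Max ((\<lambda>t. card (B t)) ` pverts T))"
    unfolding tree_width_def using assms(1)
    by (simp only: diff_add_cancel of_nat_le_iff) (rule Least_le, blast)
  also have "\<dots> \<le> int w" using T T.pair_finite_verts assms(2) by simp
  finally show ?thesis .
qed

lemma tree_width_le_cluster:
  assumes G: "pair_graph G" and K: "\<not> has_Krr_subgraph r G" and r: "2 \<le> r"
    and cluster: "cluster G m (pverts G)"
  shows "tree_width G + 1 \<le> int (max 1 (3 * m * (r - 1)))"
proof -
  interpret pair_graph G by (rule G)
  let ?w = "max 1 (3 * m * (r - 1))"
  obtain N B where "partial_decomposition ?w r G (pverts G) 1 N B"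
    using cluster_partial_decomposition[OF G K r _ _ cluster, of ?w 1] by auto
  then interpret D: partial_decomposition ?w r G "pverts G" 1 N B .
  interpret parent_pointers N 1 "\<lambda>i. i div 2"
  proof
    fix i assume "i \<in> N" "i \<noteq> 1"
    then have "1 \<le> i" using D.nodes_sub by (intro descendants_ge) auto
    then show "i div 2 < i" by simp
  qed (use D.finite_nodes D.apex_node in \<open>auto intro: D.parent_node\<close>)
  let ?T = "parent_graph N 1 (\<lambda>i. i div 2)"
  have nodes: "pverts ?T = N" by (simp add: parent_graph_def)
  have cover: "cover r G (pverts G) = {}"
    by (auto simp: cover_def small_def outer_nbrs_def)
  have "tree_decomposition G ?T B"
    unfolding tree_decomposition_def
  proof (intro conjI ballI)
    show "undirected_tree ?T" by (rule undirected_tree_parent_graph)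
    show "(\<Union>t \<in> pverts ?T. B t) = pverts G"
      unfolding nodes using D.bag_sub D.inner_vertex cover by fast
    show "case e of (u, v) \<Rightarrow> \<exists>t \<in> pverts ?T. u \<in> B t \<and> v \<in> B t" if "e \<in> parcs G" for e
      using D.edge_in_bag[of "fst e" "snd e"] that nodes in_arcsD1 in_arcsD2
      by (cases e) auto
    fix v assume "v \<in> pverts G"
    then obtain t where t: "t \<in> N" "v \<in> B t"
      and "\<forall>i \<in> N. v \<in> B i \<longrightarrow> i \<noteq> t \<longrightarrow> i \<noteq> 1 \<and> v \<in> B (i div 2)"
      using D.inner_vertex[OF \<open>v \<in> pverts G\<close>] by blast
    then show "Digraph_Component.connected
        (induce_subgraph (with_proj ?T) {t \<in> pverts ?T. v \<in> B t})"
      unfolding nodes using D.parent_node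
      by (intro connected_induced_by_apex[where apex = t]) auto
  qed
  then show ?thesis using D.card_bag nodes by (intro tree_width_le) auto
qed

section \<open>The bounds\<close>

lemma rank_width_decomposition:
  assumes "2 \<le> card (pverts G)"
  obtains T :: "nat pair_pre_digraph" and \<mu>
  where "rank_decomposition G T \<mu>" "rank_decomposition_width G T \<mu> = rank_width G"
proof -
  let ?P = "\<lambda>k. \<exists>(T :: nat pair_pre_digraph) \<mu>.
    rank_decomposition G T \<mu> \<and> k = rank_decomposition_width G T \<mu>"
  have "\<exists>k. ?P k" using ex_rank_decomposition[OF assms] by blast
  then have "?P (LEAST k. ?P k)" by (rule LeastI_ex)
  moreover have "rank_width G = (LEAST k. ?P k)" using assms by (simp add: rank_width_def)
  ultimately show thesis using that by metis
qed

lemma cut_rank_le_width: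
  assumes dec: "rank_decomposition G T \<mu>"
    and st: "(s, t) \<in> parcs T" and C: "C \<in> components (del_edge T s t)"
  shows "cut_rank G {v \<in> pverts G. \<mu> v \<in> C} \<le> rank_decomposition_width G T \<mu>"
proof -
  interpret tree_graph T
    using dec by (simp add: tree_graph_def rank_decomposition_def ternary_tree_def)
  have fin: "finite (pverts G)"
    using dec pair_finite_verts
    by (auto simp: rank_decomposition_def leaves_def dest!: bij_betw_finite)
  have "{cut_rank G {v \<in> pverts G. \<mu> v \<in> C} | s t C.
      (s, t) \<in> parcs T \<and> C \<in> components (del_edge T s t)} \<subseteq> cut_rank G ` Pow (pverts G)"
    by auto
  then have "finite {cut_rank G {v \<in> pverts G. \<mu> v \<in> C} | s t C.
      (s, t) \<in> parcs T \<and> C \<in> components (del_edge T s t)}"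
    by (rule finite_subset) (simp add: fin)
  then show ?thesis
    unfolding rank_decomposition_width_def using st C by (intro Max_ge) blast+
qed

lemma trace_bound_ge_1:
  assumes "2 \<le> r" shows "1 \<le> trace_bound r k"
proof -
  have "(\<Sum>i = 0..0. real (k choose i)) \<le> (\<Sum>i = 0..r. real (k choose i))"
    by (rule sum_mono2) auto
  moreover have "0 \<le> (real r - 2) / (real r + 1) * real (k choose r)" using assms by simp
  ultimately show ?thesis unfolding trace_bound_def by simp
qed

text \<open>
  The number \<open>m\<close> is the largest one allowed by \<open>trace_bound\<close>. A single vertex has no
  rank-decomposition and is treated separately; it has no traces.
\<close>

lemma cluster_of_rank_width:
  assumes G: "pair_graph G" and K: "\<not> has_Krr_subgraph r G" and r: "2 \<le> r"
    and "pverts G \<noteq> {}"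
  obtains m where "cluster G m (pverts G)" "real m + 1 \<le> trace_bound r (rank_width G)"
proof -
  interpret pair_graph G by (rule G)
  define m where "m = nat \<lfloor>trace_bound r (rank_width G) - 1\<rfloor>"
  have m: "real m + 1 \<le> trace_bound r (rank_width G)"
    using trace_bound_ge_1[OF r, of "rank_width G"] by (simp add: m_def)
  have "cluster G m (pverts G)"
  proof (cases "2 \<le> card (pverts G)")
    case True
    then obtain T :: "nat pair_pre_digraph" and \<mu>
      where dec: "rank_decomposition G T \<mu>" and w: "rank_decomposition_width G T \<mu> = rank_width G"
      by (rule rank_width_decomposition)
    show ?thesis
    proof (rule cluster_of_rank_decomposition[OF G dec True])
      fix s t C assume "(s, t) \<in> parcs T" "C \<in> components (del_edge T s t)"
      then have "cut_rank G {v \<in> pverts G. \<mu> v \<in> C} \<le> rank_width G"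
        using cut_rank_le_width[OF dec] w by simp
      then have "real (card (traces G {v \<in> pverts G. \<mu> v \<in> C})) + 1 \<le> trace_bound r (rank_width G)"
        by (intro card_traces_le[OF G K r]) auto
      then show "card (traces G {v \<in> pverts G. \<mu> v \<in> C}) \<le> m"
        unfolding m_def by linarith
    qed
  next
    case False
    then have "card (pverts G) = 1"
      using \<open>pverts G \<noteq> {}\<close> pair_finite_verts by (metis One_nat_def Suc_1 card_0_eq le_neq_implies_less
          less_Suc_eq_le less_one not_less_eq_eq)
    then obtain v where v: "pverts G = {v}" by (rule card_1_singletonE)
    then have "traces G {v} = {}" by (auto simp: traces_def outer_nbrs_def)
    then show ?thesis unfolding v using v by (intro cluster.single) simp_all
  qed
  then show thesis using m that by blast
qed

text \<open>
  The null graph is not a cluster, but a single empty bag decomposes it.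
\<close>

lemma tree_width_null_graph:
  assumes "pair_graph G" "pverts G = {}"
  shows "tree_width G + 1 \<le> 0"
proof -
  interpret G: pair_graph G by (rule assms(1))
  interpret parent_pointers "{0}" 0 id by unfold_locales auto
  have "parcs G = {}" using assms(2) G.in_arcsD1 by fastforce
  then have "tree_decomposition G (parent_graph {0} 0 id) (\<lambda>_. {})"
    using assms(2) undirected_tree_parent_graph by (simp add: tree_decomposition_def)
  from tree_width_le[OF this, of 0] show ?thesis by simp
qed

theorem theorem21:
  fixes G :: "'a pair_pre_digraph" and r :: nat
  assumes "r \<ge> 2"
    and "pair_graph G"
    and "\<not> has_Krr_subgraph r G"
  shows "real (clique_width G) <
           2 * (real r - 2) / (real r + 1) * real (rank_width G choose r)
             + 2 * (\<Sum>i = 0..r. real (rank_width G choose i))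
         \<and> real_of_int (tree_width G) + 1 <
             3 * (real r - 1) *
               (2 * (real r - 2) / (real r + 1) * real (rank_width G choose r)
                 + 2 * (\<Sum>i = 0..r. real (rank_width G choose i)))"
proof -
  let ?b = "trace_bound r (rank_width G)"
  have b: "2 * (real r - 2) / (real r + 1) * real (rank_width G choose r)
      + 2 * (\<Sum>i = 0..r. real (rank_width G choose i)) = 2 * ?b"
    by (simp add: trace_bound_def algebra_simps)
  have b1: "1 \<le> ?b" by (rule trace_bound_ge_1[OF assms(1)])
  have r1: "1 \<le> real r - 1" using assms(1) by simp
  have b2: "2 \<le> 2 * ?b" using b1 by simp
  show ?thesis
  proof (cases "pverts G = {}")
    case True
    have "0 < 3 * (real r - 1) * (2 * ?b)" using r1 b1 by simp
    moreover have "real_of_int (tree_width G) + 1 \<le> 0"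
      using tree_width_null_graph[OF assms(2) True] by linarith
    moreover have "clique_width G = 0" using True by (simp add: clique_width_def)
    ultimately show ?thesis unfolding b using b1 by linarith
  next
    case False
    obtain m where cluster: "cluster G m (pverts G)" and m: "real m + 1 \<le> ?b"
      using cluster_of_rank_width[OF assms(2,3,1) False] .
    have "clique_width G \<le> 2 * m + 1" by (rule clique_width_le_cluster[OF assms(2) cluster])
    then have cw: "real (clique_width G) < 2 * ?b" using m by linarith
    have "tree_width G + 1 \<le> int (max 1 (3 * m * (r - 1)))"
      by (rule tree_width_le_cluster[OF assms(2,3,1) cluster])
    then have "real_of_int (tree_width G) + 1 \<le> real (max 1 (3 * m * (r - 1)))" by linarith
    also have "\<dots> = max 1 (3 * real m * (real r - 1))"
      using assms(1) by (simp add: of_nat_diff of_nat_max)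
    also have "\<dots> < 3 * (real r - 1) * (2 * ?b)"
    proof -
      have "1 * 1 \<le> (real r - 1) * ?b" using r1 b1 by (intro mult_mono) auto
      moreover have "(real r - 1) * (real m + 1) \<le> (real r - 1) * ?b"
        using m r1 by (intro mult_left_mono) auto
      ultimately show ?thesis using r1 by (simp add: algebra_simps)
    qed
    finally show ?thesis unfolding b using cw by simp
  qed
qed

end
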